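(* There exists a $\mathsf{TOTO}$ sentence $\xi$ such that the following holds. For every $\varepsilon>0$ there is an $n_0$ such that for every $n\geq n_0$ satisfying $W^{(2)}(\log^{**}\log^{**}n-1)<\log^*\log^*\log^* n$ and every $q>0$ with $1-1/\log^* n<q<1+1/\log^* n$, the random permutation $\Pi_n\sim\mathrm{Mallows}(n,q)$ satisfies $$\mathbb{P}(\Pi_n\models\xi)\geq 1-\varepsilon\ \text{ if }\log^{**}\log^{**}n\text{ is even},\qquad \mathbb{P}(\Pi_n\models\xi)\leq\varepsilon\ \text{ if }\log^{**}\log^{**}n\text{ is odd}.$$ (That is, these probabilities are $1-o(1)$, respectively $o(1)$, with error terms uniform over all sequences $q=q(n)$ in the stated range.)
   Context: $S_n$ is the set of permutations of $[n]=\{1,\dots,n\}$. For $\pi\in S_n$, $\mathrm{inv}(\pi)=|\{(i,j): i<j,\ \pi(i)>\pi(j)\}|$. For $q>0$, $\Pi_n\sim\mathrm{Mallows}(n,q)$ means $\mathbb{P}(\Pi_n=\pi)=q^{\mathrm{inv}(\pi)}/\sum_{\sigma\in S_n}q^{\mathrm{inv}(\sigma)}$ for all $\pi\in S_n$. $\mathsf{TOTO}$ is the first-order language (with equality) having two binary relation symbols $<_1,<_2$. A permutation $\pi\in S_n$ is regarded as the structure with domain $[n]$ in which $i<_1 j$ iff $i<j$, and $i<_2 j$ iff $\pi(i)<\pi(j)$; $\pi\models\varphi$ means that this structure satisfies the sentence $\varphi$. Tower function: $T(0)=1$, $T(i)=2^{T(i-1)}$ for $i\ge1$. Wowzer function: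 $W(0)=1$, $W(n)=T(W(n-1))$ for $n\geq 1$; $W^{(2)}=W\circ W$. $\log^* n=\min\{k\in\mathbb{Z}_{\geq 0}:T(k)\geq n\}$ and $\log^{**}n=\min\{k\in\mathbb{Z}_{\geq 0}:W(k)\geq n\}$. *)

theory Defs
  imports
    "HOL-Probability.Probability_Mass_Function"
    "HOL-Combinatorics.Permutations"
begin

subsection \<open>Tower and Wowzer functions and their inverses\<close>

fun tower :: "nat \<Rightarrow> nat" where
  "tower 0 = 1"
| "tower (Suc i) = 2 ^ tower i"

fun wowzer :: "nat \<Rightarrow> nat" where
  "wowzer 0 = 1"
| "wowzer (Suc n) = tower (wowzer n)"

definition log_star :: "nat \<Rightarrow> nat" where
  "log_star n = (LEAST k. tower k \<ge> n)"

definition log_star_star :: "nat \<Rightarrow> nat" where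
  "log_star_star n = (LEAST k. wowzer k \<ge> n)"

(* The sets minimised over in log_star and log_star_star are nonempty. *)
lemma tower_gt: "k < tower k"
proof (induction k)
  case (Suc k)
  have "tower k < tower (Suc k)" by simp
  with Suc show ?case by linarith
qed simp

lemma wowzer_gt: "k < wowzer k"
proof (induction k)
  case (Suc k)
  have "wowzer k < wowzer (Suc k)" by (simp add: tower_gt)
  with Suc show ?case by linarith
qed simp

lemma tower_log_star: "n \<le> tower (log_star n)"
  unfolding log_star_def by (rule LeastI[of _ n]) (simp add: tower_gt less_imp_le)

lemma wowzer_log_star_star: "n \<le> wowzer (log_star_star n)"
  unfolding log_star_star_def by (rule LeastI[of _ n]) (simp add: wowzer_gt less_imp_le)


subsection \<open>First-order logic of two orders\<close>

(* Variables are natural numbers; the remaining connectives and the universal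
   quantifier are definable from Neg, Conj and Exists. *)
datatype toto =
    Equal nat nat
  | Less1 nat nat
  | Less2 nat nat
  | Neg toto
  | Conj toto toto
  | Exists nat toto

fun free_vars :: "toto \<Rightarrow> nat set" where
  "free_vars (Equal x y) = {x, y}"
| "free_vars (Less1 x y) = {x, y}"
| "free_vars (Less2 x y) = {x, y}"
| "free_vars (Neg \<phi>) = free_vars \<phi>"
| "free_vars (Conj \<phi> \<psi>) = free_vars \<phi> \<union> free_vars \<psi>"
| "free_vars (Exists x \<phi>) = free_vars \<phi> - {x}"

definition toto_sentence :: "toto \<Rightarrow> bool" where
  "toto_sentence \<phi> \<longleftrightarrow> free_vars \<phi> = {}"

fun toto_sat ::
  "'a set \<Rightarrow> ('a \<Rightarrow> 'a \<Rightarrow> bool) \<Rightarrow> ('a \<Rightarrow> 'a \<Rightarrow> bool) \<Rightarrow> (nat \<Rightarrow> 'a) \<Rightarrow> toto \<Rightarrow> bool" where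
  "toto_sat D R1 R2 e (Equal x y) \<longleftrightarrow> e x = e y"
| "toto_sat D R1 R2 e (Less1 x y) \<longleftrightarrow> R1 (e x) (e y)"
| "toto_sat D R1 R2 e (Less2 x y) \<longleftrightarrow> R2 (e x) (e y)"
| "toto_sat D R1 R2 e (Neg \<phi>) \<longleftrightarrow> \<not> toto_sat D R1 R2 e \<phi>"
| "toto_sat D R1 R2 e (Conj \<phi> \<psi>) \<longleftrightarrow> toto_sat D R1 R2 e \<phi> \<and> toto_sat D R1 R2 e \<psi>"
| "toto_sat D R1 R2 e (Exists x \<phi>) \<longleftrightarrow> (\<exists>a\<in>D. toto_sat D R1 R2 (e(x := a)) \<phi>)"

lemma toto_sat_cong:
  assumes "\<And>x. x \<in> free_vars \<phi> \<Longrightarrow> e x = e' x"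
  shows "toto_sat D R1 R2 e \<phi> \<longleftrightarrow> toto_sat D R1 R2 e' \<phi>"
  using assms
proof (induction \<phi> arbitrary: e e')
  case (Neg \<phi>)
  then show ?case by (metis free_vars.simps(4) toto_sat.simps(4))
next
  case (Conj \<phi> \<psi>)
  then show ?case by (metis UnI1 UnI2 free_vars.simps(5) toto_sat.simps(5))
next
  case (Exists x \<phi>)
  have "toto_sat D R1 R2 (e(x := a)) \<phi> \<longleftrightarrow> toto_sat D R1 R2 (e'(x := a)) \<phi>" for a
    by (rule Exists.IH) (use Exists.prems in auto)
  then show ?case by simp
qed auto

(* Only meant for sentences, whose truth value does not depend on the assignment e
   (models_iff below); quantifying over all e merely avoids picking one. *)
definition models :: "nat \<Rightarrow> (nat \<Rightarrow> nat) \<Rightarrow> toto \<Rightarrow> bool" where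
  "models n \<pi> \<phi> \<longleftrightarrow> (\<forall>e. toto_sat {1..n} (\<lambda>i j. i < j) (\<lambda>i j. \<pi> i < \<pi> j) e \<phi>)"

lemma models_iff:
  assumes "toto_sentence \<phi>"
  shows "models n \<pi> \<phi> \<longleftrightarrow> toto_sat {1..n} (\<lambda>i j. i < j) (\<lambda>i j. \<pi> i < \<pi> j) e \<phi>"
  unfolding models_def using assms toto_sat_cong[of \<phi>]
  by (metis empty_iff toto_sentence_def)


subsection \<open>Mallows distribution\<close>

definition inv_count :: "nat \<Rightarrow> (nat \<Rightarrow> nat) \<Rightarrow> nat" where
  "inv_count n \<pi> = card {(i, j). i \<in> {1..n} \<and> j \<in> {1..n} \<and> i < j \<and> \<pi> i > \<pi> j}"

definition mallows :: "nat \<Rightarrow> real \<Rightarrow> (nat \<Rightarrow> nat) pmf" where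
  "mallows n q = embed_pmf (\<lambda>\<pi>.
     if \<pi> permutes {1..n}
     then q ^ inv_count n \<pi> / (\<Sum>\<sigma> | \<sigma> permutes {1..n}. q ^ inv_count n \<sigma>)
     else 0)"

(* For q > 0 the weights are a probability mass function, so embed_pmf is meaningful. *)
lemma pmf_mallows:
  assumes "q > 0"
  shows "pmf (mallows n q) \<pi> =
    (if \<pi> permutes {1..n}
     then q ^ inv_count n \<pi> / (\<Sum>\<sigma> | \<sigma> permutes {1..n}. q ^ inv_count n \<sigma>)
     else 0)"
proof -
  let ?S = "{\<sigma>. \<sigma> permutes {1..n}}"
  let ?Z = "\<Sum>\<sigma>\<in>?S. q ^ inv_count n \<sigma>"
  let ?f = "\<lambda>\<pi>. if \<pi> permutes {1..n} then q ^ inv_count n \<pi> / ?Z else 0"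
  have fin: "finite ?S" by (rule finite_permutations) simp
  have "id \<in> ?S" by (simp add: permutes_id)
  then have Z: "?Z > 0" using fin assms by (intro sum_pos) (blast | simp)+
  have nonneg: "?f \<sigma> \<ge> 0" for \<sigma> using Z assms by simp
  have "(\<integral>\<^sup>+\<sigma>. ennreal (?f \<sigma>) \<partial>count_space UNIV)
      = (\<Sum>\<sigma>\<in>?S. ennreal (?f \<sigma>))"
    by (rule nn_integral_count_space'[OF fin]) auto
  also have "\<dots> = ennreal (\<Sum>\<sigma>\<in>?S. ?f \<sigma>)"
    using nonneg by (intro sum_ennreal) blast
  also have "(\<Sum>\<sigma>\<in>?S. ?f \<sigma>) = (\<Sum>\<sigma>\<in>?S. q ^ inv_count n \<sigma> / ?Z)"
    by (intro sum.cong) auto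
  also have "\<dots> = 1" using Z by (simp flip: sum_divide_distrib)
  finally have "(\<integral>\<^sup>+\<sigma>. ennreal (?f \<sigma>) \<partial>count_space UNIV) = 1" by simp
  then show ?thesis
    unfolding mallows_def using nonneg by (intro pmf_embed_pmf) auto
qed

end

theory Submission
  imports Defs
begin

text \<open>
  Regard the first s positions as a copy of {1,...,s}. Their values cut the value axis into
  gaps, so every other position names the base position just below it in value, or none, and
  a window of consecutive positions spells a word over {0,...,s}. Hence a pair of positions can
  encode a binary relation on {1,...,s}. If every relation on {1,...,s} is encoded (s is rich,
  a first-order property), first-order logic can quantify over binary relations on {1,...,s}
  and thus define 2x, 2^x, T and W by iteration. The sentence takes the largest rich s and
  asserts that the largest c with W(W(c)) < s is odd. As s is at most n, only the lower bound
  s > W(W(k-1)) with k = log** log** n is needed for c = k - 1, and by hypothesis it suffices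
  that log* log* log* n is rich with high probability.

  This number is tiny compared with log* n, and permuting the first K positions changes the
  weight of a permutation by a factor of at most max(q,1/q)^(K^2), which is bounded for
  |q - 1| < 1 / log* n and K^2 < log* n. So one may average over replacing the entries at the
  first J positions by entries from J independent uniform positions among the next R. With
  high probability the base values are then well separated, and each word of the relevant
  length is spelled by one of very many disjoint windows.
\<close>

section \<open>Second-order arithmetic inside a permutation\<close>

definition toto_le :: "nat \<Rightarrow> nat \<Rightarrow> toto" where
  "toto_le x y = Neg (Less1 y x)"

definition toto_disj :: "toto \<Rightarrow> toto \<Rightarrow> toto" where
  "toto_disj \<phi> \<psi> = Neg (Conj (Neg \<phi>) (Neg \<psi>))"

definition toto_iff :: "toto \<Rightarrow> toto \<Rightarrow> toto" where
  "toto_iff \<phi> \<psi> = Conj (Neg (Conj \<phi> (Neg \<psi>))) (Neg (Conj \<psi> (Neg \<phi>)))"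

definition toto_all :: "nat \<Rightarrow> toto \<Rightarrow> toto" where
  "toto_all x \<phi> = Neg (Exists x (Neg \<phi>))"

definition toto_ex_le :: "nat \<Rightarrow> nat \<Rightarrow> toto \<Rightarrow> toto" where
  "toto_ex_le s x \<phi> = Exists x (Conj (toto_le x s) \<phi>)"

definition toto_all_le :: "nat \<Rightarrow> nat \<Rightarrow> toto \<Rightarrow> toto" where
  "toto_all_le s x \<phi> = Neg (toto_ex_le s x (Neg \<phi>))"

abbreviation sat :: "nat \<Rightarrow> (nat \<Rightarrow> nat) \<Rightarrow> (nat \<Rightarrow> nat) \<Rightarrow> toto \<Rightarrow> bool" where
  "sat n \<pi> \<equiv> toto_sat {Suc 0..n} (\<lambda>i j. i < j) (\<lambda>i j. \<pi> i < \<pi> j)"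

lemma sat_derived [simp]:
  "sat n \<pi> e (toto_le x y) \<longleftrightarrow> e x \<le> e y"
  "sat n \<pi> e (toto_disj \<phi> \<psi>) \<longleftrightarrow> sat n \<pi> e \<phi> \<or> sat n \<pi> e \<psi>"
  "sat n \<pi> e (toto_iff \<phi> \<psi>) \<longleftrightarrow> (sat n \<pi> e \<phi> \<longleftrightarrow> sat n \<pi> e \<psi>)"
  "sat n \<pi> e (toto_all x \<phi>) \<longleftrightarrow> (\<forall>a\<in>{1..n}. sat n \<pi> (e(x := a)) \<phi>)"
  "s \<noteq> x \<Longrightarrow> sat n \<pi> e (toto_ex_le s x \<phi>) \<longleftrightarrow> (\<exists>a\<in>{1..n}. a \<le> e s \<and> sat n \<pi> (e(x := a)) \<phi>)"
  "s \<noteq> x \<Longrightarrow> sat n \<pi> e (toto_all_le s x \<phi>) \<longleftrightarrow> (\<forall>a\<in>{1..n}. a \<le> e s \<longrightarrow> sat n \<pi> (e(x := a)) \<phi>)"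
  by (simp_all add: toto_le_def toto_disj_def toto_iff_def toto_all_def toto_ex_le_def toto_all_le_def
      not_less) blast

lemma free_vars_derived [simp]:
  "free_vars (toto_le x y) = {x, y}"
  "free_vars (toto_disj \<phi> \<psi>) = free_vars \<phi> \<union> free_vars \<psi>"
  "free_vars (toto_iff \<phi> \<psi>) = free_vars \<phi> \<union> free_vars \<psi>"
  "free_vars (toto_all x \<phi>) = free_vars \<phi> - {x}"
  "free_vars (toto_ex_le s x \<phi>) = ({s} \<union> free_vars \<phi>) - {x}"
  "free_vars (toto_all_le s x \<phi>) = ({s} \<union> free_vars \<phi>) - {x}"
  by (auto simp: toto_le_def toto_disj_def toto_iff_def toto_all_def toto_ex_le_def toto_all_le_def)

section \<open>Relations coded by windows of positions\<close>

definition succ_in :: "nat \<Rightarrow> nat \<Rightarrow> nat \<Rightarrow> bool" where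
  "succ_in n a b \<longleftrightarrow> a < b \<and> \<not> (\<exists>c\<in>{1..n}. a < c \<and> c < b)"

text \<open>The letter of \<open>p\<close> is the base position whose value is closest below that of
  \<open>p\<close>. For injective \<open>\<pi>\<close> there is at most one such \<open>x\<close>. A
  position lying below all base values has no letter, which is how the letter 0 of the later words
  is realised.\<close>

definition code_in :: "nat \<Rightarrow> (nat \<Rightarrow> nat) \<Rightarrow> nat \<Rightarrow> nat \<Rightarrow> nat \<Rightarrow> bool" where
  "code_in n \<pi> s p x \<longleftrightarrow> x \<le> s \<and> \<pi> x < \<pi> p \<and> \<not> (\<exists>z\<in>{1..n}. z \<le> s \<and> \<pi> x < \<pi> z \<and> \<pi> z < \<pi> p)"

text \<open>Pairs of letters are read off adjacent positions of the window from \<open>i\<close> to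
  \<open>j\<close>, so that two first-order variables stand for a whole binary relation.\<close>

definition rel_in :: "nat \<Rightarrow> (nat \<Rightarrow> nat) \<Rightarrow> nat \<Rightarrow> nat \<Rightarrow> nat \<Rightarrow> nat \<Rightarrow> nat \<Rightarrow> bool" where
  "rel_in n \<pi> s i j x y \<longleftrightarrow> (\<exists>p\<in>{1..n}. \<exists>p'\<in>{1..n}. i \<le> p \<and> p' \<le> j \<and> succ_in n p p' \<and>
     code_in n \<pi> s p x \<and> code_in n \<pi> s p' y)"

definition rich :: "nat \<Rightarrow> (nat \<Rightarrow> nat) \<Rightarrow> nat \<Rightarrow> bool" where
  "rich n \<pi> s \<longleftrightarrow> (\<forall>A. \<exists>i\<in>{1..n}. \<exists>j\<in>{1..n}. \<forall>x\<in>{1..n}. \<forall>y\<in>{1..n}. x \<le> s \<longrightarrow> y \<le> s \<longrightarrow>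
     (rel_in n \<pi> s i j x y \<longleftrightarrow> (x, y) \<in> A))"

lemma succ_in_iff: "a \<le> n \<Longrightarrow> b \<le> n \<Longrightarrow> succ_in n a b \<longleftrightarrow> b = Suc a"
  unfolding succ_in_def by (auto intro: less_antisym dest: bspec[of _ _ "Suc a"] simp: not_less_eq)

(* Second-order quantification over relations on {1..s} is only meaningful once every relation
   is coded; closure of the coded relations under adding a single pair expresses this in
   first-order terms. *)
lemma rich_iff_insert_closed:
  assumes "n \<ge> 1"
  shows "rich n \<pi> s \<longleftrightarrow>
    (\<forall>i\<in>{1..n}. \<forall>j\<in>{1..n}. \<forall>x\<in>{1..n}. x \<le> s \<longrightarrow> (\<forall>y\<in>{1..n}. y \<le> s \<longrightarrow>
      (\<exists>i'\<in>{1..n}. \<exists>j'\<in>{1..n}. \<forall>x'\<in>{1..n}. x' \<le> s \<longrightarrow> (\<forall>y'\<in>{1..n}. y' \<le> s \<longrightarrow>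
        (rel_in n \<pi> s i' j' x' y' \<longleftrightarrow> rel_in n \<pi> s i j x' y' \<or> x' = x \<and> y' = y)))))"
    (is "_ \<longleftrightarrow> ?C")
proof
  assume R: "rich n \<pi> s"
  show ?C
  proof (intro ballI impI)
    fix i j x y
    show "\<exists>i'\<in>{1..n}. \<exists>j'\<in>{1..n}. \<forall>x'\<in>{1..n}. x' \<le> s \<longrightarrow> (\<forall>y'\<in>{1..n}. y' \<le> s \<longrightarrow>
        (rel_in n \<pi> s i' j' x' y' \<longleftrightarrow> rel_in n \<pi> s i j x' y' \<or> x' = x \<and> y' = y))"
      using R[unfolded rich_def, rule_format,
          of "{(x', y'). rel_in n \<pi> s i j x' y' \<or> x' = x \<and> y' = y}"] by simp
  qed
next
  assume C: ?C
  let ?D = "{1..n} \<inter> {..s}"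
  have coded: "\<exists>i\<in>{1..n}. \<exists>j\<in>{1..n}. \<forall>x\<in>?D. \<forall>y\<in>?D. rel_in n \<pi> s i j x y \<longleftrightarrow> (x, y) \<in> A"
    if "finite A" "A \<subseteq> ?D \<times> ?D" for A
    using that
  proof (induction A rule: finite_induct)
    case empty
    show ?case
      \<comment> \<open>A window of one position contains no two consecutive positions and hence
        codes the empty relation.\<close>
      by (rule bexI[of _ 1], rule bexI[of _ 1]) (use assms in \<open>auto simp: rel_in_def succ_in_def\<close>)
  next
    case (insert a A)
    then have "A \<subseteq> ?D \<times> ?D" by simp
    from insert.IH[OF this] obtain i j where ij: "i \<in> {1..n}" "j \<in> {1..n}"
      "\<forall>x\<in>?D. \<forall>y\<in>?D. rel_in n \<pi> s i j x y \<longleftrightarrow> (x, y) \<in> A"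
      by (elim bexE) (rule that)
    obtain x y where a: "a = (x, y)" "x \<in> ?D" "y \<in> ?D" using insert.prems by (cases a) auto
    have "x \<in> {1..n}" "x \<le> s" "y \<in> {1..n}" "y \<le> s" using a by auto
    from C[rule_format, OF ij(1,2) this] obtain i' j' where "i' \<in> {1..n}" "j' \<in> {1..n}"
      "\<forall>x'\<in>{1..n}. x' \<le> s \<longrightarrow> (\<forall>y'\<in>{1..n}. y' \<le> s \<longrightarrow>
        (rel_in n \<pi> s i' j' x' y' \<longleftrightarrow> rel_in n \<pi> s i j x' y' \<or> x' = x \<and> y' = y))"
      by (elim bexE) (rule that)
    then have "\<forall>x'\<in>?D. \<forall>y'\<in>?D. rel_in n \<pi> s i' j' x' y' \<longleftrightarrow> rel_in n \<pi> s i j x' y' \<or> x' = x \<and> y' = y"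
      by simp
    then have "\<forall>x'\<in>?D. \<forall>y'\<in>?D. rel_in n \<pi> s i' j' x' y' \<longleftrightarrow> (x', y') \<in> insert a A"
      using ij(3) a(1) by (simp add: disj_commute)
    then show ?case using \<open>i' \<in> {1..n}\<close> \<open>j' \<in> {1..n}\<close> by blast
  qed
  show "rich n \<pi> s" unfolding rich_def
  proof
    fix A :: "(nat \<times> nat) set"
    from coded[of "A \<inter> ?D \<times> ?D"]
    obtain i j where "i \<in> {1..n}" "j \<in> {1..n}"
      "\<forall>x\<in>?D. \<forall>y\<in>?D. rel_in n \<pi> s i j x y \<longleftrightarrow> (x, y) \<in> A \<inter> ?D \<times> ?D"
      by (auto simp: finite_subset)
    then show "\<exists>i\<in>{1..n}. \<exists>j\<in>{1..n}. \<forall>x\<in>{1..n}. \<forall>y\<in>{1..n}. x \<le> s \<longrightarrow> y \<le> s \<longrightarrow>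
      (rel_in n \<pi> s i j x y \<longleftrightarrow> (x, y) \<in> A)"
      by (intro bexI[of _ i] bexI[of _ j]) auto
  qed
qed

section \<open>Functions defined by iteration\<close>

definition represents :: "nat \<Rightarrow> (nat \<Rightarrow> nat) \<Rightarrow> (nat \<Rightarrow> nat \<Rightarrow> bool) \<Rightarrow> bool" where
  "represents s f F \<longleftrightarrow> (\<forall>x\<in>{1..s}. \<forall>y\<in>{1..s}. F x y \<longleftrightarrow> y = f x)"

text \<open>This is the recursion G(1) = 2, G(x + 1) = F(G(x)), cut off at \<open>s\<close> and
  written without numerals: an \<open>x\<close> with no smaller element is 1, and its successor is
  2. The starting value 2 is common to 2x, 2^x, \<open>tower\<close> and
  \<open>wowzer\<close>.\<close>

definition iter_in :: "nat \<Rightarrow> nat \<Rightarrow> (nat \<Rightarrow> nat \<Rightarrow> bool) \<Rightarrow> (nat \<Rightarrow> nat \<Rightarrow> bool) \<Rightarrow> bool" where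
  "iter_in n s F G \<longleftrightarrow> (\<forall>x\<in>{1..n}. x \<le> s \<longrightarrow> (\<forall>y\<in>{1..n}. y \<le> s \<longrightarrow>
     (G x y \<longleftrightarrow> \<not> (\<exists>z\<in>{1..n}. z < x) \<and> succ_in n x y \<or>
       (\<exists>x'\<in>{1..n}. x' \<le> s \<and> (\<exists>y'\<in>{1..n}. y' \<le> s \<and> succ_in n x' x \<and> G x' y' \<and> F y' y)))))"

text \<open>Cutting the recursion off at \<open>s\<close> does no harm because \<open>f\<close>
  increases its argument: whenever g(x + 1) lies in {1..s}, so does the value g(x) from which it is
  computed. Hence the recursion determines \<open>G\<close> on {1..s} row by row.\<close>

lemma iter_in_iff_represents:
  assumes "s \<le> n" and F: "represents s f F" and f: "\<And>x. x \<ge> 1 \<Longrightarrow> f x > x"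
    and g: "g 1 = 2" "\<And>x. x \<ge> 1 \<Longrightarrow> g (Suc x) = f (g x)"
  shows "iter_in n s F G \<longleftrightarrow> represents s g G"
proof -
  have g_pos: "g x \<ge> 1" if "x \<ge> 1" for x
    using that
  proof (induction x rule: dec_induct)
    case (step m)
    then show ?case using g(2)[of m] f[of "g m"] by linarith
  qed (use g in simp)
  \<comment> \<open>The right-hand side of the recursion in plain arithmetic. The relation is a
    parameter, so that \<open>G\<close> can be compared with the graph of \<open>g\<close>.\<close>
  define E where "E G' x y \<longleftrightarrow> x = 1 \<and> y = 2 \<or>
    (\<exists>x'\<in>{1..s}. \<exists>y'\<in>{1..s}. x = Suc x' \<and> G' x' y' \<and> y = f y')" for G' :: "nat \<Rightarrow> nat \<Rightarrow> bool" and x y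
  have iter: "iter_in n s F G \<longleftrightarrow> (\<forall>x\<in>{1..s}. \<forall>y\<in>{1..s}. G x y \<longleftrightarrow> E G x y)"
  proof -
    have "(\<not> (\<exists>z\<in>{1..n}. z < x) \<and> succ_in n x y \<or>
       (\<exists>x'\<in>{1..n}. x' \<le> s \<and> (\<exists>y'\<in>{1..n}. y' \<le> s \<and> succ_in n x' x \<and> G x' y' \<and> F y' y)))
       \<longleftrightarrow> E G x y" if xy: "x \<in> {1..s}" "y \<in> {1..s}" for x y
    proof -
      have "(\<exists>z\<in>{1..n}. z < x) \<longleftrightarrow> x \<noteq> 1" using xy assms(1) by (auto intro!: bexI[of _ 1])
      moreover have "succ_in n a b \<longleftrightarrow> b = Suc a" if "a \<le> s" "b \<le> s" for a b
        using that assms(1) by (simp add: succ_in_iff)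
      moreover have "F y' y \<longleftrightarrow> y = f y'" if "y' \<in> {1..s}" for y'
        using F that xy by (auto simp: represents_def)
      moreover have "(\<exists>x'\<in>{1..n}. x' \<le> s \<and> P x') \<longleftrightarrow> (\<exists>x'\<in>{1..s}. P x')" for P
        using assms(1) by auto
      ultimately show ?thesis using xy unfolding E_def by (auto simp: numeral_2_eq_2)
    qed
    moreover have bounded: "(\<forall>x\<in>{1..n}. x \<le> s \<longrightarrow> P x) \<longleftrightarrow> (\<forall>x\<in>{1..s}. P x)" for P
      using assms(1) by auto
    ultimately show ?thesis unfolding iter_in_def bounded
      by (intro ball_cong[OF refl] arg_cong2[of _ _ _ _ "(=)"] refl)
  qed
  have gE: "y = g x \<longleftrightarrow> E (\<lambda>x' y'. y' = g x') x y" if xy: "x \<in> {1..s}" "y \<in> {1..s}" for x y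
  proof (cases "x = 1")
    case True
    then show ?thesis using g(1) by (auto simp: E_def)
  next
    case False
    then obtain x' where x': "x = Suc x'" "x' \<ge> 1" using xy by (cases x) auto
    have "g x' \<in> {1..s}" if "y = f (g x')"
      using f[of "g x'"] g_pos[OF x'(2)] that xy by auto
    then show ?thesis using xy x' g(2)[of x'] by (auto simp: E_def)
  qed
  show ?thesis
  proof
    assume I: "iter_in n s F G"
    have "\<forall>y\<in>{1..s}. G x y \<longleftrightarrow> y = g x" if "x \<ge> 1" "x \<le> s" for x
      using that
    proof (induction x rule: dec_induct)
      case base
      then show ?case using I gE[of 1] unfolding iter E_def by auto
    next
      case (step m)
      then have IH: "\<forall>y\<in>{1..s}. G m y \<longleftrightarrow> y = g m" by simp
      have "G (Suc m) y \<longleftrightarrow> y = g (Suc m)" if "y \<in> {1..s}" for y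
      proof -
        have "G (Suc m) y \<longleftrightarrow> E G (Suc m) y" using I iter step.prems that by simp
        also have "\<dots> \<longleftrightarrow> E (\<lambda>x' y'. y' = g x') (Suc m) y" using IH by (auto simp: E_def)
        also have "\<dots> \<longleftrightarrow> y = g (Suc m)" using gE[of "Suc m" y] step.prems that by simp
        finally show ?thesis .
      qed
      then show ?case by blast
    qed
    then show "represents s g G" by (auto simp: represents_def)
  next
    assume "represents s g G"
    then have "E G x y \<longleftrightarrow> E (\<lambda>x' y'. y' = g x') x y" if "x \<in> {1..s}" "y \<in> {1..s}" for x y
      using that by (auto simp: E_def represents_def)
    with gE \<open>represents s g G\<close> show "iter_in n s F G" unfolding iter by (simp add: represents_def)
  qed
qed

section \<open>First-order formulas for the coded notions\<close>

definition toto_succ :: "nat \<Rightarrow> nat \<Rightarrow> toto" where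
  "toto_succ x y = Conj (Less1 x y) (Neg (Exists 30 (Conj (Less1 x 30) (Less1 30 y))))"

definition toto_code :: "nat \<Rightarrow> nat \<Rightarrow> nat \<Rightarrow> toto" where
  "toto_code s p x = Conj (toto_le x s) (Conj (Less2 x p)
     (Neg (toto_ex_le s 31 (Conj (Less2 x 31) (Less2 31 p)))))"

definition toto_rel :: "nat \<Rightarrow> nat \<Rightarrow> nat \<Rightarrow> nat \<Rightarrow> nat \<Rightarrow> toto" where
  "toto_rel s i j x y = Exists 32 (Exists 33 (Conj (toto_le i 32) (Conj (toto_le 33 j)
     (Conj (toto_succ 32 33) (Conj (toto_code s 32 x) (toto_code s 33 y))))))"

text \<open>Bound variables come in disjoint blocks: 30 to 33 for the auxiliary formulas, 10 to 17
  for richness and iteration, 20 to 24 for \<open>toto_parity\<close>, which leaves 0 to 9 for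
  parameters. This prevents unintended capture and makes every freshness condition decidable by
  \<open>simp\<close>.\<close>

definition toto_rich :: "nat \<Rightarrow> toto" where
  "toto_rich s = toto_all 10 (toto_all 11 (toto_all_le s 12 (toto_all_le s 13
     (Exists 14 (Exists 15 (toto_all_le s 16 (toto_all_le s 17
       (toto_iff (toto_rel s 14 15 16 17)
         (toto_disj (toto_rel s 10 11 16 17) (Conj (Equal 16 12) (Equal 17 13)))))))))))"

(* The step formula F is applied to the variables 13 and 11. *)
definition toto_iter :: "nat \<Rightarrow> toto \<Rightarrow> nat \<Rightarrow> nat \<Rightarrow> toto" where
  "toto_iter s F i j = toto_all_le s 10 (toto_all_le s 11 (toto_iff (toto_rel s i j 10 11)
     (toto_disj (Conj (Neg (Exists 14 (Less1 14 10))) (toto_succ 10 11))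
       (toto_ex_le s 12 (toto_ex_le s 13
         (Conj (toto_succ 12 10) (Conj (toto_rel s i j 12 13) F)))))))"

(* The variable pairs (1,2), (3,4), (5,6), (7,8) code the graphs of 2x, 2^x, T and W on {1..s};
   the variable 20 is the largest c with W(W(c)) < s. *)
definition toto_parity :: toto where
  "toto_parity =
    (let W = toto_rel 0 7 8;
       below = (\<lambda>c. toto_ex_le 0 22 (toto_ex_le 0 23 (Conj (W c 22) (Conj (W 22 23) (Less1 23 0)))))
     in Exists 1 (Exists 2 (Exists 3 (Exists 4 (Exists 5 (Exists 6 (Exists 7 (Exists 8
       (Conj (toto_iter 0 (Exists 14 (Conj (toto_succ 13 14) (toto_succ 14 11))) 1 2)
       (Conj (toto_iter 0 (toto_rel 0 1 2 13 11) 3 4)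
       (Conj (toto_iter 0 (toto_rel 0 3 4 13 11) 5 6)
       (Conj (toto_iter 0 (toto_rel 0 5 6 13 11) 7 8)
       (toto_ex_le 0 20 (Conj (Neg (toto_ex_le 0 21 (toto_rel 0 1 2 21 20)))
         (Conj (below 20) (toto_all_le 0 24 (Neg (Conj (Less1 20 24) (below 24)))))))))))))))))))"

definition toto_xi :: toto where
  "toto_xi = Exists 0 (Conj (toto_rich 0) (Conj
     (Neg (Exists 9 (Conj (Less1 0 9) (toto_rich 9)))) toto_parity))"

lemma free_vars_succ [simp]:
  "x \<noteq> 30 \<Longrightarrow> y \<noteq> 30 \<Longrightarrow> free_vars (toto_succ x y) = {x, y}"
  by (auto simp: toto_succ_def)

lemma free_vars_rel [simp]:
  "{30, 31, 32, 33} \<inter> {s, i, j, x, y} = {} \<Longrightarrow> free_vars (toto_rel s i j x y) = {s, i, j, x, y}"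
  by (auto simp: toto_rel_def toto_code_def)

lemma toto_sentence_xi: "toto_sentence toto_xi"
  by (simp add: toto_sentence_def toto_xi_def toto_rich_def toto_parity_def toto_iter_def Let_def
      insert_Diff_if)

lemma sat_succ [simp]:
  "x \<noteq> 30 \<Longrightarrow> y \<noteq> 30 \<Longrightarrow> sat n \<pi> e (toto_succ x y) \<longleftrightarrow> succ_in n (e x) (e y)"
  by (simp add: toto_succ_def succ_in_def)

lemma sat_code [simp]:
  "31 \<notin> {s, p, x} \<Longrightarrow> sat n \<pi> e (toto_code s p x) \<longleftrightarrow> code_in n \<pi> (e s) (e p) (e x)"
  by (auto simp add: toto_code_def code_in_def)

lemma sat_rel [simp]:
  "{31, 32, 33} \<inter> {s, i, j, x, y} = {} \<Longrightarrow>
    sat n \<pi> e (toto_rel s i j x y) \<longleftrightarrow> rel_in n \<pi> (e s) (e i) (e j) (e x) (e y)"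
  by (auto simp add: toto_rel_def rel_in_def)

lemma sat_rich:
  assumes "n \<ge> 1" "s < 10"
  shows "sat n \<pi> e (toto_rich s) \<longleftrightarrow> rich n \<pi> (e s)"
  using assms by (simp add: rich_iff_insert_closed toto_rich_def)

lemma sat_iter:
  assumes "s < 10" "i < 10" "j < 10" and F: "10 \<notin> free_vars F" "12 \<notin> free_vars F"
  shows "sat n \<pi> e (toto_iter s F i j) \<longleftrightarrow>
    iter_in n (e s) (\<lambda>x y. sat n \<pi> (e(13 := x, 11 := y)) F) (rel_in n \<pi> (e s) (e i) (e j))"
proof -
  \<comment> \<open>Of the four variables bound around \<open>F\<close>, only 11 and 13 may occur
    free in it.\<close>
  have "sat n \<pi> (e(10 := a, 11 := b, 12 := c, 13 := d)) F \<longleftrightarrow> sat n \<pi> (e(13 := d, 11 := b)) F" for a b c d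
    by (rule toto_sat_cong) (use F in auto)
  then show ?thesis using assms(1-3) by (simp add: toto_iter_def iter_in_def)
qed

section \<open>Truth value of the sentence\<close>

lemma strict_mono_tower: "strict_mono tower"
  by (rule strict_monoI_Suc) simp

lemma strict_mono_wowzer: "strict_mono wowzer"
  by (rule strict_monoI_Suc) (simp add: tower_gt)

text \<open>Richness guarantees that codes for the four graphs exist, and the iteration formulas pin
  these graphs down on {1..s}, so the truth value does not depend on which codes are chosen. The
  condition \<open>c \<ge> 1\<close> appears because the domain starts at 1.\<close>

lemma sat_parity:
  assumes rich: "rich n \<pi> s" and s: "1 \<le> s" "s \<le> n" and e: "e 0 = s"
  shows "sat n \<pi> e toto_parity \<longleftrightarrow>
    (\<exists>c\<ge>1. odd c \<and> wowzer (wowzer c) < s \<and> (\<forall>c'>c. \<not> wowzer (wowzer c') < s))" (is "_ \<longleftrightarrow> ?X")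
proof -
  let ?R = "\<lambda>i j. rel_in n \<pi> s i j"
  let ?below = "\<lambda>i j c. \<exists>y\<in>{1..n}. y \<le> s \<and> (\<exists>z\<in>{1..n}. z \<le> s \<and> ?R i j c y \<and> ?R i j y z \<and> z < s)"
  let ?Q = "\<lambda>a b g h. \<exists>c\<in>{1..n}. c \<le> s \<and> \<not> (\<exists>x\<in>{1..n}. x \<le> s \<and> ?R a b x c) \<and> ?below g h c \<and>
     (\<forall>c'\<in>{1..n}. c' \<le> s \<longrightarrow> \<not> (c < c' \<and> ?below g h c'))"
  let ?all = "\<lambda>a b c d f g h i. represents s (\<lambda>x. 2 * x) (?R a b) \<and> represents s (\<lambda>x. 2 ^ x) (?R c d) \<and>
     represents s tower (?R f g) \<and> represents s wowzer (?R h i)"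
  let ?I = "\<lambda>a b c d f g h i. iter_in n s (\<lambda>x y. \<exists>z\<in>{1..n}. succ_in n x z \<and> succ_in n z y) (?R a b) \<and>
      iter_in n s (?R a b) (?R c d) \<and> iter_in n s (?R c d) (?R f g) \<and> iter_in n s (?R f g) (?R h i)"
  have sat: "sat n \<pi> e toto_parity \<longleftrightarrow>
    (\<exists>a\<in>{1..n}. \<exists>b\<in>{1..n}. \<exists>c\<in>{1..n}. \<exists>d\<in>{1..n}. \<exists>f\<in>{1..n}. \<exists>g\<in>{1..n}. \<exists>h\<in>{1..n}. \<exists>i\<in>{1..n}.
      ?I a b c d f g h i \<and> ?Q a b h i)"
    by (simp add: toto_parity_def Let_def sat_iter e)
  have I_iff: "?I a b c d f g h i \<longleftrightarrow> ?all a b c d f g h i" for a b c d f g h i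
  proof -
    \<comment> \<open>Each function iterates the previous one: doubling iterates x + 2, powers of
      two iterate doubling, \<open>tower\<close> iterates powers of two, and \<open>wowzer\<close>
      iterates \<open>tower\<close>.\<close>
    have "represents s (\<lambda>x. x + 2) (\<lambda>x y. \<exists>z\<in>{1..n}. succ_in n x z \<and> succ_in n z y)"
      using s by (auto simp: represents_def succ_in_iff intro!: bexI[of _ "Suc _"])
    from iter_in_iff_represents[OF s(2) this, of "\<lambda>x. 2 * x"]
    have 1: "iter_in n s (\<lambda>x y. \<exists>z\<in>{1..n}. succ_in n x z \<and> succ_in n z y) G \<longleftrightarrow>
      represents s (\<lambda>x. 2 * x) G" for G by simp
    have 2: "iter_in n s F G \<longleftrightarrow> represents s (\<lambda>x. 2 ^ x) G" if "represents s (\<lambda>x. 2 * x) F" for F G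
      by (rule iter_in_iff_represents[OF s(2) that]) auto
    have 3: "iter_in n s F G \<longleftrightarrow> represents s tower G" if "represents s (\<lambda>x. 2 ^ x) F" for F G
      by (rule iter_in_iff_represents[OF s(2) that]) auto
    have 4: "iter_in n s F G \<longleftrightarrow> represents s wowzer G" if "represents s tower F" for F G
      by (rule iter_in_iff_represents[OF s(2) that]) (auto simp: tower_gt)
    show ?thesis using 1 2 3 4 by meson
  qed
  have Q_iff: "?Q a b h i \<longleftrightarrow> ?X" if "?all a b c d f g h i" for a b c d f g h i
  proof -
    from that have D: "?R a b x y \<longleftrightarrow> y = 2 * x" and W: "?R h i x y \<longleftrightarrow> y = wowzer x"
      if "x \<in> {1..s}" "y \<in> {1..s}" for x y using that by (auto simp: represents_def)
    have below: "?below h i c \<longleftrightarrow> wowzer (wowzer c) < s" if "c \<in> {1..s}" for c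
    proof
      assume "?below h i c"
      then obtain y z where "y \<in> {1..s}" "z \<in> {1..s}" "?R h i c y" "?R h i y z" "z < s" by auto
      then show "wowzer (wowzer c) < s" using W[of c y] W[of y z] that by simp
    next
      assume *: "wowzer (wowzer c) < s"
      moreover have "wowzer c < wowzer (wowzer c)" "wowzer c > 0"
        using wowzer_gt by (auto intro: le_less_trans)
      ultimately show "?below h i c"
        using W[of c "wowzer c"] W[of "wowzer c" "wowzer (wowzer c)"] that s
        by (intro bexI[of _ "wowzer c"] conjI bexI[of _ "wowzer (wowzer c)"]) auto
    qed
    have even: "(\<exists>x\<in>{1..n}. x \<le> s \<and> ?R a b x c) \<longleftrightarrow> even c" if c: "c \<in> {1..s}" for c
    proof
      assume "\<exists>x\<in>{1..n}. x \<le> s \<and> ?R a b x c"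
      then obtain x where "x \<in> {1..s}" "?R a b x c" by auto
      then show "even c" using D[OF _ c] by simp
    next
      assume "even c"
      then obtain x where "c = 2 * x" by blast
      then show "\<exists>x\<in>{1..n}. x \<le> s \<and> ?R a b x c"
        using c s D[OF _ c, of x] by (intro bexI[of _ x]) auto
    qed
    \<comment> \<open>Since \<open>wowzer\<close> exceeds its argument, every \<open>c\<close> that
      matters is below \<open>s\<close>, so restricting the quantifiers to {1..s} changes
      nothing.\<close>
    have lt: "c < s" if "wowzer (wowzer c) < s" for c
      using that wowzer_gt[of c] wowzer_gt[of "wowzer c"] by linarith
    have bounded: "(\<exists>c\<in>{1..n}. c \<le> s \<and> \<not> P c \<and> P' c \<and> (\<forall>c'\<in>{1..n}. c' \<le> s \<longrightarrow> \<not> (c < c' \<and> P' c'))) \<longleftrightarrow>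
      (\<exists>c\<in>{1..s}. \<not> P c \<and> P' c \<and> (\<forall>c'\<in>{1..s}. \<not> (c < c' \<and> P' c')))" for P P'
    proof -
      have "(\<exists>c\<in>{1..n}. c \<le> s \<and> X c) \<longleftrightarrow> (\<exists>c\<in>{1..s}. X c)"
        "(\<forall>c\<in>{1..n}. c \<le> s \<longrightarrow> X c) \<longleftrightarrow> (\<forall>c\<in>{1..s}. X c)" for X using s by auto
      then show ?thesis by presburger
    qed
    have "?Q a b h i \<longleftrightarrow> (\<exists>c\<in>{1..s}. odd c \<and> wowzer (wowzer c) < s \<and>
        (\<forall>c'\<in>{1..s}. \<not> (c < c' \<and> wowzer (wowzer c') < s)))"
      unfolding bounded
      by (intro bex_cong[OF refl] conj_cong ball_cong[OF refl] arg_cong[of _ _ Not] refl even below)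
    also have "\<dots> \<longleftrightarrow> (\<exists>c\<ge>1. odd c \<and> wowzer (wowzer c) < s \<and> (\<forall>c'>c. \<not> wowzer (wowzer c') < s))"
    proof -
      have "(\<forall>c'\<in>{1..s}. \<not> (c < c' \<and> wowzer (wowzer c') < s)) \<longleftrightarrow>
        (\<forall>c'>c. \<not> wowzer (wowzer c') < s)" for c
      proof
        assume *: "\<forall>c'\<in>{1..s}. \<not> (c < c' \<and> wowzer (wowzer c') < s)"
        have "\<not> wowzer (wowzer c') < s" if "c' > c" for c'
          using bspec[OF *, of c'] lt[of c'] that by auto
        then show "\<forall>c'>c. \<not> wowzer (wowzer c') < s" by blast
      qed blast
      moreover have "c \<in> {1..s} \<longleftrightarrow> c \<ge> 1" if "wowzer (wowzer c) < s" for c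
        using lt[OF that] by auto
      ultimately show ?thesis by blast
    qed
    finally show ?thesis .
  qed
  show ?thesis
  proof
    assume "sat n \<pi> e toto_parity"
    then obtain a b c d f g h i where I: "?I a b c d f g h i" and Q: "?Q a b h i"
      unfolding sat by (elim bexE conjE) (rule that; blast)
    from I have "?all a b c d f g h i" by (subst (asm) I_iff)
    from Q_iff[OF this] Q show ?X by (rule iffD1)
  next
    assume X: ?X
    \<comment> \<open>Richness applied to the graph of \<open>f\<close>. Only the part of the graph
      inside {1..s} has to be coded.\<close>
    have "\<exists>i j. i \<in> {1..n} \<and> j \<in> {1..n} \<and> represents s f (?R i j)" for f
    proof -
      from rich[unfolded rich_def, rule_format, of "{(x, y). y = f x}"]
      obtain i j where "i \<in> {1..n}" "j \<in> {1..n}"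
        "\<forall>x\<in>{1..n}. \<forall>y\<in>{1..n}. x \<le> s \<longrightarrow> y \<le> s \<longrightarrow> (?R i j x y \<longleftrightarrow> (x, y) \<in> {(x, y). y = f x})"
        by (elim bexE) (rule that)
      moreover from this(3) have "represents s f (?R i j)"
        unfolding represents_def using s by simp
      ultimately show ?thesis by blast
    qed
    then obtain i j where ij: "i f \<in> {1..n}" "j f \<in> {1..n}" "represents s f (?R (i f) (j f))" for f
      by metis
    let ?D = "\<lambda>x. 2 * x" and ?E = "\<lambda>x. 2 ^ x"
    have all: "?all (i ?D) (j ?D) (i ?E) (j ?E) (i tower) (j tower) (i wowzer) (j wowzer)"
      by (intro conjI ij)
    show "sat n \<pi> e toto_parity" unfolding sat
      by (rule bexI[of _ "i ?D"], rule bexI[of _ "j ?D"], rule bexI[of _ "i ?E"], rule bexI[of _ "j ?E"],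
          rule bexI[of _ "i tower"], rule bexI[of _ "j tower"], rule bexI[of _ "i wowzer"],
          rule bexI[of _ "j wowzer"], rule conjI[OF iffD2[OF I_iff all] iffD2[OF Q_iff[OF all] X]];
          rule ij)
  qed
qed

text \<open>Whatever the largest rich \<open>s\<close> is, it lies between \<open>s\<^sub>0\<close>
  and \<open>n\<close>, hence strictly above W(W(k - 1)) and at most at W(W(k)). The largest c with
  W(W(c)) < s is therefore k - 1, and \<open>k \<ge> 2\<close> makes it an element of the
  domain.\<close>

lemma models_xi_iff:
  assumes rich: "rich n \<pi> s\<^sub>0" and s\<^sub>0: "s\<^sub>0 \<le> n"
    and k: "k \<ge> 2" "wowzer (wowzer (k - 1)) < s\<^sub>0" "n \<le> wowzer (wowzer k)"
  shows "models n \<pi> toto_xi \<longleftrightarrow> even k"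
proof -
  have n: "n \<ge> 1" using s\<^sub>0 k(2) by linarith
  define s where "s = Max {s\<in>{1..n}. rich n \<pi> s}"
  have "s\<^sub>0 \<in> {s\<in>{1..n}. rich n \<pi> s}" using rich s\<^sub>0 k(2) by auto
  then have "s \<in> {s\<in>{1..n}. rich n \<pi> s}" and le: "s\<^sub>0 \<le> s"
    unfolding s_def by (intro Max_in Max_ge; (blast | simp))+
  then have s: "s \<in> {1..n}" "rich n \<pi> s" by blast+
  have max: "\<not> rich n \<pi> s'" if "s < s'" "s' \<in> {1..n}" for s'
  proof
    assume "rich n \<pi> s'"
    then have "s' \<le> s" unfolding s_def using that(2) by (intro Max_ge) auto
    with that(1) show False by simp
  qed
  have uniq: "s' = s" if "s' \<in> {1..n}" "rich n \<pi> s'" "\<forall>t\<in>{1..n}. s' < t \<longrightarrow> \<not> rich n \<pi> t" for s'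
    using that s max by (metis linorder_neqE_nat)
  have "models n \<pi> toto_xi \<longleftrightarrow> sat n \<pi> (\<lambda>_. s) toto_parity"
  proof -
    have "models n \<pi> toto_xi \<longleftrightarrow> (\<exists>s'\<in>{1..n}. rich n \<pi> s' \<and> (\<forall>t\<in>{1..n}. s' < t \<longrightarrow> \<not> rich n \<pi> t) \<and>
        sat n \<pi> ((\<lambda>_. s)(0 := s')) toto_parity)"
      unfolding models_iff[OF toto_sentence_xi, of n \<pi> "\<lambda>_. s"]
      using n by (simp add: sat_rich toto_xi_def)
    also have "\<dots> \<longleftrightarrow> sat n \<pi> ((\<lambda>_. s)(0 := s)) toto_parity"
      using uniq s max by blast
    also have "(\<lambda>_. s)(0 := s) = (\<lambda>_. s)" by (rule fun_upd_idem) simp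
    finally show ?thesis .
  qed
  also have "\<dots> \<longleftrightarrow> (\<exists>c\<ge>1. odd c \<and> wowzer (wowzer c) < s \<and> (\<forall>c'>c. \<not> wowzer (wowzer c') < s))"
    using s by (intro sat_parity) auto
  also have "\<dots> \<longleftrightarrow> odd (k - 1)"
  proof -
    have below: "wowzer (wowzer c) < s \<longleftrightarrow> c \<le> k - 1" for c
    proof
      assume "wowzer (wowzer c) < s"
      then have "wowzer (wowzer c) < wowzer (wowzer k)" using k(3) s(1) by simp
      then show "c \<le> k - 1" using k(1) by (simp add: strict_mono_less[OF strict_mono_wowzer])
    next
      assume "c \<le> k - 1"
      then have "wowzer (wowzer c) \<le> wowzer (wowzer (k - 1))"
        by (simp add: strict_mono_less_eq[OF strict_mono_wowzer])
      then show "wowzer (wowzer c) < s" using k(2) le by simp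
    qed
    show ?thesis
    proof
      assume "odd (k - 1)"
      then show "\<exists>c\<ge>1. odd c \<and> wowzer (wowzer c) < s \<and> (\<forall>c'>c. \<not> wowzer (wowzer c') < s)"
        using below k(1) by (intro exI[of _ "k - 1"]) auto
    next
      assume "\<exists>c\<ge>1. odd c \<and> wowzer (wowzer c) < s \<and> (\<forall>c'>c. \<not> wowzer (wowzer c') < s)"
      then obtain c where "odd c" "c \<le> k - 1" "\<forall>c'>c. \<not> c' \<le> k - 1" unfolding below by blast
      then show "odd (k - 1)" by (metis le_neq_implies_less order_refl)
    qed
  qed
  also have "\<dots> \<longleftrightarrow> even k" using k(1) by simp
  finally show ?thesis .
qed

section \<open>Counting lists that spell all words\<close>

text \<open>Build the list from left to right: at each step at most \<open>m\<close> elements of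
  \<open>A\<close> spoil \<open>Q\<close>, so at least \<open>card A - m\<close> continuations
  remain.\<close>

lemma card_lists_greedy:
  fixes A :: "'a set"
  assumes "finite A" and "Q []"
    and step: "\<And>xs. length xs < l \<Longrightarrow> set xs \<subseteq> A \<Longrightarrow> Q xs \<Longrightarrow> card {a\<in>A. \<not> Q (xs @ [a])} \<le> m"
  shows "(card A - m) ^ l \<le> card {xs. set xs \<subseteq> A \<and> length xs = l \<and> Q xs}"
  using step
proof (induction l)
  case 0
  have "{xs. set xs \<subseteq> A \<and> length xs = 0 \<and> Q xs} = {[]}" using assms(2) by auto
  then show ?case by simp
next
  case (Suc l)
  let ?S = "\<lambda>l. {xs. set xs \<subseteq> A \<and> length xs = l \<and> Q xs}"
  let ?N = "\<lambda>xs. {a\<in>A. Q (xs @ [a])}"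
  have fin: "finite (?S l)" for l
    by (rule finite_subset[OF _ finite_lists_length_eq[OF assms(1), of l]]) auto
  have N: "card A - m \<le> card (?N xs)" if "xs \<in> ?S l" for xs
  proof -
    have "card A = card (?N xs \<union> {a\<in>A. \<not> Q (xs @ [a])})" by (rule arg_cong[of _ _ card]) auto
    also have "\<dots> \<le> card (?N xs) + card {a\<in>A. \<not> Q (xs @ [a])}" by (rule card_Un_le)
    also have "\<dots> \<le> card (?N xs) + m" using Suc.prems that by simp
    finally show ?thesis by simp
  qed
  have "(card A - m) ^ Suc l \<le> card (?S l) * (card A - m)"
    using Suc.IH Suc.prems by (simp add: mult.commute)
  also have "\<dots> \<le> (\<Sum>xs\<in>?S l. card (?N xs))"
    using sum_bounded_below[of "?S l" "card A - m" "\<lambda>xs. card (?N xs)"] N by simp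
  also have "\<dots> = card (SIGMA xs:?S l. ?N xs)"
    using fin assms(1) by (subst card_SigmaI) auto
  also have "\<dots> = card ((\<lambda>(xs, a). xs @ [a]) ` (SIGMA xs:?S l. ?N xs))"
    by (rule card_image[symmetric]) (auto simp: inj_on_def)
  also have "\<dots> \<le> card (?S (Suc l))" by (rule card_mono[OF fin]) auto
  finally show ?case .
qed

text \<open>Consecutive blocks of length \<open>t\<close> are chosen independently, and at most
  \<open>card A ^ t - e\<close> choices of a block avoid \<open>M\<close>. The induction splits off
  the first block.\<close>

lemma card_lists_blocks_avoid:
  fixes A :: "'a set"
  assumes A: "finite A" and e: "e \<le> card {zs. set zs \<subseteq> A \<and> length zs = t \<and> M zs}"
  shows "card {ys. set ys \<subseteq> A \<and> length ys = B * t \<and> (\<forall>b<B. \<not> M (take t (drop (b * t) ys)))}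
    \<le> (card A ^ t - e) ^ B"
proof (induction B)
  case 0
  have "{ys. set ys \<subseteq> A \<and> length ys = 0 * t \<and> (\<forall>b<0. \<not> M (take t (drop (b * t) ys)))} = {[]}" by auto
  then show ?case by simp
next
  case (Suc B)
  let ?L = "{zs. set zs \<subseteq> A \<and> length zs = t}" and ?E = "{zs. set zs \<subseteq> A \<and> length zs = t \<and> M zs}"
  let ?N = "\<lambda>B. {ys. set ys \<subseteq> A \<and> length ys = B * t \<and> (\<forall>b<B. \<not> M (take t (drop (b * t) ys)))}"
  have finL: "finite ?L" by (rule finite_lists_length_eq[OF A])
  have finN: "finite (?N B)"
    by (rule finite_subset[OF _ finite_lists_length_eq[OF A, of "B * t"]]) auto
  have "?N (Suc B) \<subseteq> (\<lambda>(zs, ws). zs @ ws) ` ((?L - ?E) \<times> ?N B)"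
  proof
    fix ys assume ys: "ys \<in> ?N (Suc B)"
    then have "\<not> M (take t ys)" by (auto dest!: spec[of _ 0])
    moreover have "\<not> M (take t (drop (b * t) (drop t ys)))" if "b < B" for b
      using ys that by (auto dest!: spec[of _ "Suc b"] simp: add.commute)
    moreover have "set (take t ys) \<subseteq> A" "set (drop t ys) \<subseteq> A"
      using ys set_take_subset[of t ys] set_drop_subset[of t ys] by auto
    ultimately have "(take t ys, drop t ys) \<in> (?L - ?E) \<times> ?N B"
      using ys by auto
    then show "ys \<in> (\<lambda>(zs, ws). zs @ ws) ` ((?L - ?E) \<times> ?N B)"
      by (rule rev_image_eqI) simp
  qed
  then have "card (?N (Suc B)) \<le> card ((?L - ?E) \<times> ?N B)"
    using finL finN by (intro surj_card_le) auto
  also have "\<dots> = (card ?L - card ?E) * card (?N B)"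
    using finL by (subst card_cartesian_product, subst card_Diff_subset) (auto intro: finite_subset[rotated])
  also have "\<dots> \<le> (card A ^ t - e) * (card A ^ t - e) ^ B"
    using Suc.IH e by (intro mult_mono) (auto simp: card_lists_length_eq[OF A])
  finally show ?case by simp
qed

text \<open>Each entry ranges freely over the \<open>d\<close> members of its prescribed cell,
  namely the numbers \<open>\<tau> j * d + r\<close> with r < d.\<close>

lemma card_lists_cells:
  assumes "\<And>j. j < t \<Longrightarrow> \<tau> j < H"
  shows "d ^ t \<le> card {zs. set zs \<subseteq> {..<H * d} \<and> length zs = t \<and> (\<forall>j<t. zs ! j div d = \<tau> j)}"
proof -
  let ?L = "{ys :: nat list. set ys \<subseteq> {..<d} \<and> length ys = t}"
  let ?f = "\<lambda>ys. map (\<lambda>j. \<tau> j * d + ys ! j) [0..<t]"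
  have "inj_on ?f ?L"
  proof (rule inj_onI)
    fix xs ys assume xy: "xs \<in> ?L" "ys \<in> ?L" "?f xs = ?f ys"
    show "xs = ys"
    proof (rule nth_equalityI)
      show "length xs = length ys" using xy by simp
      fix j assume "j < length xs"
      then show "xs ! j = ys ! j" using arg_cong[OF xy(3), of "\<lambda>zs. zs ! j"] xy(1) by simp
    qed
  qed
  moreover have "?f ` ?L \<subseteq> {zs. set zs \<subseteq> {..<H * d} \<and> length zs = t \<and> (\<forall>j<t. zs ! j div d = \<tau> j)}"
  proof clarsimp
    fix ys :: "nat list" assume ys: "set ys \<subseteq> {..<d}" and t: "t = length ys"
    have lt: "ys ! j < d" if "j < length ys" for j using ys that nth_mem by blast
    have "\<tau> j * d + ys ! j < H * d" if "j < length ys" for j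
    proof -
      have "\<tau> j * d + ys ! j < Suc (\<tau> j) * d" using lt[OF that] by simp
      also have "\<dots> \<le> H * d" using assms[of j] that t by (intro mult_right_mono) auto
      finally show ?thesis .
    qed
    moreover have "(\<tau> j * d + ys ! j) div d = \<tau> j" if "j < length ys" for j
      using lt[OF that] by (simp add: div_mult_self3)
    ultimately show "(\<lambda>j. \<tau> j * d + ys ! j) ` {0..<length ys} \<subseteq> {..<H * d} \<and>
        (\<forall>j<length ys. (\<tau> j * d + ys ! j) div d = \<tau> j)"
      by auto
  qed
  moreover have "finite {zs. set zs \<subseteq> {..<H * d} \<and> length zs = t \<and> (\<forall>j<t. zs ! j div d = \<tau> j)}"
    by (rule finite_subset[OF _ finite_lists_length_eq[of "{..<H * d}" t]]) auto
  ultimately have "card ?L \<le> card {zs. set zs \<subseteq> {..<H * d} \<and> length zs = t \<and> (\<forall>j<t. zs ! j div d = \<tau> j)}"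
    by (rule card_inj_on_le)
  then show ?thesis by (simp add: card_lists_length_eq)
qed

(* The ranks below H d fall into H cells of d consecutive ranks. For spaced base elements the
   cell right above that of a base element x lies in the value gap just above x. *)
definition spaced :: "nat \<Rightarrow> nat \<Rightarrow> nat list \<Rightarrow> bool" where
  "spaced d H xs \<longleftrightarrow> (\<forall>x\<in>set xs. x div d \<noteq> 0 \<and> Suc (x div d) \<noteq> H) \<and>
     sorted_wrt (\<lambda>x y. x div d \<noteq> y div d \<and> x div d \<noteq> Suc (y div d) \<and> y div d \<noteq> Suc (x div d)) xs"

(* The letter w stands for the base element at position w of the list f; the letter 0 means
   "below all base elements". *)
definition letter_cell :: "nat \<Rightarrow> nat list \<Rightarrow> nat \<Rightarrow> nat" where
  "letter_cell d f w = (if w = 0 then 0 else Suc (f ! (w - 1) div d))"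

text \<open>The first \<open>s\<close> entries are the base. Then come \<open>B\<close> disjoint
  windows of length \<open>t\<close>, each of which is one attempt at spelling a word.\<close>

definition spells_all :: "nat \<Rightarrow> nat \<Rightarrow> nat \<Rightarrow> nat \<Rightarrow> nat list \<Rightarrow> bool" where
  "spells_all d s t B u \<longleftrightarrow> (\<forall>w. set w \<subseteq> {..s} \<and> length w = t \<longrightarrow>
     (\<exists>b<B. \<forall>j<t. u ! (s + b * t + j) div d = letter_cell d u (w ! j)))"

lemma card_div_in:
  assumes "finite C" "d > 0"
  shows "card {a. a < R \<and> a div d \<in> C} \<le> card C * (d :: nat)"
proof -
  have "{a. a < R \<and> a div d \<in> C} \<subseteq> (\<Union>c\<in>C. {c * d..<c * d + d})"
  proof clarify
    fix a assume "a div d \<in> C"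
    moreover have "a \<in> {a div d * d..<a div d * d + d}"
      using dividend_less_div_times[OF assms(2), of a] by (simp add: div_times_less_eq_dividend add.commute)
    ultimately show "a \<in> (\<Union>c\<in>C. {c * d..<c * d + d})" by blast
  qed
  then have "card {a. a < R \<and> a div d \<in> C} \<le> card (\<Union>c\<in>C. {c * d..<c * d + d})"
    using assms by (intro card_mono) auto
  also have "\<dots> \<le> (\<Sum>c\<in>C. card {c * d..<c * d + d})" by (rule card_UN_le[OF assms(1)])
  finally show ?thesis by simp
qed

text \<open>Greedy construction: besides the two end cells, each of the fewer than \<open>s\<close>
  earlier entries forbids its own cell and the two neighbouring ones. This makes at most 2 + 3 (s -
  1) <= 5 s forbidden cells of \<open>d\<close> ranks each.\<close>

lemma card_spaced:
  assumes "d > 0"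
  shows "(H * d - 5 * s * d) ^ s \<le> card {xs. set xs \<subseteq> {..<H * d} \<and> length xs = s \<and> spaced d H xs}"
proof -
  have "(card {..<H * d} - 5 * s * d) ^ s \<le> card {xs. set xs \<subseteq> {..<H * d} \<and> length xs = s \<and> spaced d H xs}"
  proof (rule card_lists_greedy[where Q = "spaced d H"])
    fix xs :: "nat list" assume xs: "length xs < s" "spaced d H xs"
    let ?c = "\<lambda>x. x div d"
    let ?C = "{0, H - 1} \<union> (?c ` set xs \<union> (\<lambda>x. ?c x - 1) ` set xs \<union> (\<lambda>x. Suc (?c x)) ` set xs)"
    have "{a\<in>{..<H * d}. \<not> spaced d H (xs @ [a])} \<subseteq> {a. a < H * d \<and> a div d \<in> ?C}"
    proof
      fix a assume a: "a \<in> {a\<in>{..<H * d}. \<not> spaced d H (xs @ [a])}"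
      then have "\<not> (?c a \<noteq> 0 \<and> Suc (?c a) \<noteq> H \<and>
        (\<forall>x\<in>set xs. ?c x \<noteq> ?c a \<and> ?c x \<noteq> Suc (?c a) \<and> ?c a \<noteq> Suc (?c x)))"
        using xs(2) by (auto simp: spaced_def sorted_wrt_append)
      then consider "?c a = 0" | "?c a = H - 1" | x where "x \<in> set xs" "?c a = ?c x \<or> ?c a = ?c x - 1 \<or> ?c a = Suc (?c x)"
        by force
      then have "a div d \<in> ?C" by cases auto
      with a show "a \<in> {a. a < H * d \<and> a div d \<in> ?C}" by blast
    qed
    then have "card {a\<in>{..<H * d}. \<not> spaced d H (xs @ [a])} \<le> card {a. a < H * d \<and> a div d \<in> ?C}"
      by (intro card_mono) auto
    also have "\<dots> \<le> card ?C * d" by (rule card_div_in) (use assms in auto)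
    also have "\<dots> \<le> 5 * s * d"
    proof (rule mult_right_mono)
      have "card {0, H - 1} \<le> 2" by (simp add: card_insert_if)
      then have "card ?C \<le> 2 + (length xs + length xs + length xs)"
        by (intro order.trans[OF card_Un_le] add_mono order.trans[OF card_image_le card_length] finite_set)
      then show "card ?C \<le> 5 * s" using xs(1) by simp
    qed simp
    finally show "card {a\<in>{..<H * d}. \<not> spaced d H (xs @ [a])} \<le> 5 * s * d" .
  qed (auto simp: spaced_def)
  then show ?thesis by simp
qed

lemma card_distinct_lists:
  "(R - J) ^ J \<le> card {xs. set xs \<subseteq> {..<R} \<and> length xs = J \<and> distinct (xs :: nat list)}"
proof -
  have "(card {..<R} - J) ^ J \<le> card {xs. set xs \<subseteq> {..<R} \<and> length xs = J \<and> distinct (xs :: nat list)}"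
  proof (rule card_lists_greedy)
    fix xs :: "nat list" assume xs: "length xs < J" "distinct xs"
    have "{a\<in>{..<R}. \<not> distinct (xs @ [a])} \<subseteq> set xs" using xs(2) by auto
    then have "card {a\<in>{..<R}. \<not> distinct (xs @ [a])} \<le> card (set xs)" by (intro card_mono) auto
    also have "\<dots> \<le> J" using xs(1) card_length[of xs] by simp
    finally show "card {a\<in>{..<R}. \<not> distinct (xs @ [a])} \<le> J" .
  qed auto
  then show ?thesis by simp
qed

text \<open>Union bound over three failures: a repeated entry, a base that is not spaced, and, for a
  spaced base, one of the (s + 1)^t words missing from all \<open>B\<close> windows. The three
  summands bound these counts in this order.\<close>

lemma card_bad_lists:
  fixes d H s t B :: nat
  assumes "d > 0" "H > 0"
  defines "R \<equiv> H * d" and "J \<equiv> s + B * t"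
  shows "card {u. set u \<subseteq> {..<R} \<and> length u = J \<and>
      \<not> (distinct u \<and> spaced d H (take s u) \<and> spells_all d s t B u)}
    \<le> (R ^ J - (R - J) ^ J) + (R ^ s - (R - 5 * s * d) ^ s) * R ^ (B * t)
      + Suc s ^ t * (R ^ s * (R ^ t - d ^ t) ^ B)"
proof -
  let ?L = "\<lambda>k. {u. set u \<subseteq> {..<R} \<and> length u = k}"
  let ?W = "{w. set w \<subseteq> {..s} \<and> length w = t}"
  let ?app = "\<lambda>(f, ys). f @ (ys :: nat list)"
  let ?M = "\<lambda>f w zs. \<forall>j<t. zs ! j div d = letter_cell d f (w ! j)"
  let ?N = "\<lambda>f w. {ys. set ys \<subseteq> {..<R} \<and> length ys = B * t \<and> (\<forall>b<B. \<not> ?M f w (take t (drop (b * t) ys)))}"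
  let ?S = "{f \<in> ?L s. spaced d H f}"
  let ?bad1 = "?L J - {u \<in> ?L J. distinct u}"
  let ?bad2 = "?app ` ((?L s - ?S) \<times> ?L (B * t))"
  let ?bad3 = "\<Union>w\<in>?W. ?app ` (SIGMA f:?S. ?N f w)"
  have fin: "finite (?L k)" "card (?L k) = R ^ k" for k
    by (auto simp: finite_lists_length_eq card_lists_length_eq)
  have finN: "finite (?N f w)" for f w by (rule finite_subset[OF _ fin(1)[of "B * t"]]) auto
  have finS: "finite ?S" by (rule finite_subset[OF _ fin(1)[of s]]) auto
  have W: "finite ?W" "card ?W = Suc s ^ t"
    by (auto simp: finite_lists_length_eq card_lists_length_eq)
  have "{u. set u \<subseteq> {..<R} \<and> length u = J \<and>
      \<not> (distinct u \<and> spaced d H (take s u) \<and> spells_all d s t B u)} \<subseteq> ?bad1 \<union> ?bad2 \<union> ?bad3"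
  proof (rule subsetI, rule ccontr)
    fix u assume u: "u \<in> {u. set u \<subseteq> {..<R} \<and> length u = J \<and>
      \<not> (distinct u \<and> spaced d H (take s u) \<and> spells_all d s t B u)}" and nu: "u \<notin> ?bad1 \<union> ?bad2 \<union> ?bad3"
    have f: "take s u \<in> ?L s" and ys: "drop s u \<in> ?L (B * t)"
      using u set_take_subset[of s u] set_drop_subset[of s u] by (auto simp: J_def)
    have u_eq: "u = ?app (take s u, drop s u)" by simp
    from nu u have "distinct u" by auto
    moreover have sp: "spaced d H (take s u)"
    proof (rule ccontr)
      assume "\<not> spaced d H (take s u)"
      then have "(take s u, drop s u) \<in> (?L s - ?S) \<times> ?L (B * t)" using f ys by blast
      then have "u \<in> ?bad2" by (rule rev_image_eqI) (rule u_eq)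
      with nu show False by blast
    qed
    moreover have "spells_all d s t B u" unfolding spells_all_def
    proof (intro allI impI, rule ccontr)
      fix w assume w: "set w \<subseteq> {..s} \<and> length w = t"
        and no: "\<not> (\<exists>b<B. \<forall>j<t. u ! (s + b * t + j) div d = letter_cell d u (w ! j))"
      \<comment> \<open>The cell of a letter depends only on the first \<open>s\<close> entries.
        Once the base is fixed, the windows are therefore independent trials for a fixed
        target.\<close>
      have cell: "letter_cell d u (w ! j) = letter_cell d (take s u) (w ! j)" if "j < t" for j
      proof -
        have "w ! j \<in> set w" using w that by simp
        then have "w ! j \<le> s" using w by auto
        then show ?thesis using f by (auto simp: letter_cell_def)
      qed
      have "\<not> ?M (take s u) w (take t (drop (b * t) (drop s u)))" if b: "b < B" for b
      proof
        assume M: "?M (take s u) w (take t (drop (b * t) (drop s u)))"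
        have "u ! (s + b * t + j) div d = letter_cell d u (w ! j)" if j: "j < t" for j
        proof -
          have le: "s + b * t \<le> length u" using u b by (simp add: J_def)
          have "b * t + j < Suc b * t" using j by simp
          also have "\<dots> \<le> B * t" using b by (intro mult_right_mono) auto
          finally have "take t (drop (b * t) (drop s u)) ! j = u ! (s + b * t + j)"
            using j nth_drop[OF le, of j] by (simp add: add.commute)
          then show ?thesis using M[rule_format, OF j] cell[OF j] by simp
        qed
        with no b show False by blast
      qed
      then have "(take s u, drop s u) \<in> (SIGMA f:?S. ?N f w)" using f ys sp by simp
      then have "u \<in> ?app ` (SIGMA f:?S. ?N f w)" by (rule rev_image_eqI) (rule u_eq)
      then have "u \<in> ?bad3" using w by blast
      with nu show False by blast
    qed
    ultimately show False using u by blast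
  qed
  then have "card {u. set u \<subseteq> {..<R} \<and> length u = J \<and>
      \<not> (distinct u \<and> spaced d H (take s u) \<and> spells_all d s t B u)} \<le> card (?bad1 \<union> ?bad2 \<union> ?bad3)"
  proof (intro card_mono finite_UnI)
    show "finite ?bad3" by (intro finS finite_UN_I finite_imageI finite_SigmaI W finN)
  qed (auto intro!: finite_imageI finite_cartesian_product simp: fin(1))
  also have "\<dots> \<le> card ?bad1 + card ?bad2 + card ?bad3"
    by (intro order.trans[OF card_Un_le] add_mono order.refl)
  also have "\<dots> \<le> (R ^ J - (R - J) ^ J) + (R ^ s - (R - 5 * s * d) ^ s) * R ^ (B * t)
      + Suc s ^ t * (R ^ s * (R ^ t - d ^ t) ^ B)"
  proof (intro add_mono)
    have "card ?bad1 = card (?L J) - card {u \<in> ?L J. distinct u}"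
      using fin by (intro card_Diff_subset) (auto intro: finite_subset[OF _ fin(1)])
    then show "card ?bad1 \<le> R ^ J - (R - J) ^ J"
      using card_distinct_lists[of R J] fin(2)[of J] by (simp add: conj_assoc)
  next
    have "card (?L s - ?S) = card (?L s) - card ?S"
      using fin by (intro card_Diff_subset) (auto intro: finite_subset[OF _ fin(1)])
    also have "\<dots> \<le> R ^ s - (R - 5 * s * d) ^ s"
      using card_spaced[OF assms(1), of H s] fin(2)[of s] by (simp add: conj_assoc R_def)
    finally have "card ((?L s - ?S) \<times> ?L (B * t)) \<le> (R ^ s - (R - 5 * s * d) ^ s) * R ^ (B * t)"
      by (simp add: card_cartesian_product fin(2))
    then show "card ?bad2 \<le> (R ^ s - (R - 5 * s * d) ^ s) * R ^ (B * t)"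
      by (rule order.trans[OF card_image_le, rotated]) (use fin in auto)
  next
    have "card (?app ` (SIGMA f:?S. ?N f w)) \<le> R ^ s * (R ^ t - d ^ t) ^ B" if w: "w \<in> ?W" for w
    proof -
      have N: "card (?N f w) \<le> (R ^ t - d ^ t) ^ B" if f: "f \<in> ?S" for f
      proof -
        have "letter_cell d f (w ! j) < H" if "j < t" for j
        proof -
          have "w ! j \<in> set w" using w that by simp
          then have le: "w ! j \<le> s" using w by auto
          show ?thesis
          proof (cases "w ! j = 0")
            case True
            then show ?thesis using assms(2) by (simp add: letter_cell_def)
          next
            case False
            then have in_f: "f ! (w ! j - 1) \<in> set f" using f le by (intro nth_mem) auto
            then have "f ! (w ! j - 1) < H * d" using f by (auto simp: R_def)
            then have "f ! (w ! j - 1) div d < H" by (simp add: less_mult_imp_div_less)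
            \<comment> \<open>Spacing keeps base elements out of the top cell, so the cell right
              above a base element still exists.\<close>
            moreover have "Suc (f ! (w ! j - 1) div d) \<noteq> H" using f in_f by (auto simp: spaced_def)
            ultimately show ?thesis using False by (simp add: letter_cell_def)
          qed
        qed
        from card_lists_cells[of t "\<lambda>j. letter_cell d f (w ! j)", OF this]
        show ?thesis
          using card_lists_blocks_avoid[of "{..<R}" "d ^ t" t "?M f w" B] by (simp add: R_def)
      qed
      have "card (?app ` (SIGMA f:?S. ?N f w)) \<le> card (SIGMA f:?S. ?N f w)"
        by (intro card_image_le finite_SigmaI finN finS)
      also have "\<dots> = (\<Sum>f\<in>?S. card (?N f w))"
        by (rule card_SigmaI[OF finS]) (use finN in blast)
      also have "\<dots> \<le> card ?S * (R ^ t - d ^ t) ^ B"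
        using sum_bounded_above[of ?S "\<lambda>f. card (?N f w)"] N by simp
      also have "\<dots> \<le> R ^ s * (R ^ t - d ^ t) ^ B"
        unfolding fin(2)[symmetric] using fin(1) by (intro mult_right_mono card_mono) auto
      finally show ?thesis .
    qed
    then have "(\<Sum>w\<in>?W. card (?app ` (SIGMA f:?S. ?N f w))) \<le> card ?W * (R ^ s * (R ^ t - d ^ t) ^ B)"
      using sum_bounded_above[of ?W "\<lambda>w. card (?app ` (SIGMA f:?S. ?N f w))"] by simp
    then show "card ?bad3 \<le> Suc s ^ t * (R ^ s * (R ^ t - d ^ t) ^ B)"
      using card_UN_le[OF W(1), of "\<lambda>w. ?app ` (SIGMA f:?S. ?N f w)"] W(2) by simp
  qed
  finally show ?thesis .
qed

section \<open>Richness from spelling all words\<close>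

lemma spaced_apart:
  assumes "spaced d H xs" "i < length xs" "j < length xs" "i \<noteq> j"
  shows "xs ! i div d \<noteq> xs ! j div d" "xs ! i div d \<noteq> Suc (xs ! j div d)"
proof -
  have "xs ! a div d \<noteq> xs ! b div d \<and> xs ! a div d \<noteq> Suc (xs ! b div d) \<and> xs ! b div d \<noteq> Suc (xs ! a div d)"
    if "a < b" "b < length xs" for a b
    using assms(1) that by (auto simp: spaced_def sorted_wrt_iff_nth_less)
  from this[of i j] this[of j i] show "xs ! i div d \<noteq> xs ! j div d" "xs ! i div d \<noteq> Suc (xs ! j div d)"
    using assms(2-4) by (cases i j rule: linorder_cases; simp)+
qed

text \<open>By spacing, neither the cell of base element \<open>w\<close> nor the cell above it
  contains another base element, so an entry in the latter has \<open>w\<close> as its closest base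
  element from below. Cell 0 lies below all base elements, so for w = 0 there is no code.\<close>

lemma code_in_letter:
  assumes u: "spaced d H (take s u)" "s \<le> length u" "length u \<le> n"
    and order: "\<And>i j. i < length u \<Longrightarrow> j < length u \<Longrightarrow> \<pi> (Suc i) < \<pi> (Suc j) \<longleftrightarrow> u ! i < u ! j"
    and k: "k < length u" "u ! k div d = letter_cell d u w" "w \<le> s"
    and x: "1 \<le> x" "x \<le> s"
  shows "code_in n \<pi> s (Suc k) x \<longleftrightarrow> w = x"
proof -
  let ?c = "\<lambda>i. u ! i div d"
  have apart: "?c i \<noteq> ?c j" "?c i \<noteq> Suc (?c j)" if "i < s" "j < s" "i \<noteq> j" for i j
    using spaced_apart[OF u(1), of i j] that u(2) by auto
  have pos: "?c i \<noteq> 0" if "i < s" for i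
  proof -
    have "u ! i \<in> set (take s u)" using that u(2) by (auto simp: in_set_conv_nth)
    then show ?thesis using u(1) by (auto simp: spaced_def)
  qed
  have lt: "u ! i < u ! j" if "?c i < ?c j" for i j
    using that by (metis div_le_mono linorder_not_less)
  obtain i where i: "x = Suc i" "i < s" using x by (cases x) auto
  have order': "\<pi> (Suc a) < \<pi> (Suc b) \<longleftrightarrow> u ! a < u ! b" if "a < s \<or> a = k" "b < s \<or> b = k" for a b
    using order[of a b] that k(1) u(2) by auto
  have code: "code_in n \<pi> s (Suc k) x \<longleftrightarrow> u ! i < u ! k \<and> \<not> (\<exists>z<s. u ! i < u ! z \<and> u ! z < u ! k)"
  proof -
    have "(\<exists>z\<in>{1..n}. z \<le> s \<and> P z) \<longleftrightarrow> (\<exists>z<s. P (Suc z))" for P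
    proof
      assume "\<exists>z\<in>{1..n}. z \<le> s \<and> P z"
      then obtain z where "z \<in> {1..n}" "z \<le> s" "P z" by blast
      then show "\<exists>z<s. P (Suc z)" by (intro exI[of _ "z - 1"]) auto
    next
      assume "\<exists>z<s. P (Suc z)"
      then obtain z where "z < s" "P (Suc z)" by blast
      then show "\<exists>z\<in>{1..n}. z \<le> s \<and> P z" using u(2,3) by (intro bexI[of _ "Suc z"]) auto
    qed
    then show ?thesis unfolding code_in_def using i order' by auto
  qed
  show ?thesis
  proof (cases "w = 0")
    case True
    then have "?c k < ?c i" using pos[OF i(2)] k(2) by (simp add: letter_cell_def)
    then have "\<not> u ! i < u ! k" using lt[of k i] by simp
    then show ?thesis using code x True by auto
  next
    case False
    then obtain v where v: "w = Suc v" "v < s" using k(3) by (cases w) auto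
    then have ck: "?c k = Suc (?c v)" using k(2) by (simp add: letter_cell_def)
    show ?thesis
    proof
      assume "w = x"
      then have vi: "v = i" using v i by simp
      have "\<not> (u ! i < u ! z \<and> u ! z < u ! k)" if z: "z < s" for z
      proof
        assume *: "u ! i < u ! z \<and> u ! z < u ! k"
        then have "?c i \<le> ?c z" "?c z \<le> ?c k" by (auto intro!: div_le_mono)
        then have "?c i \<le> ?c z" "?c z \<le> Suc (?c i)" using ck vi by simp_all
        moreover have "z \<noteq> i" using * by auto
        ultimately show False using apart[OF z i(2)] by force
      qed
      then show "code_in n \<pi> s (Suc k) x" using code lt[of i k] ck vi by auto
    next
      assume C: "code_in n \<pi> s (Suc k) x"
      show "w = x"
      proof (rule ccontr)
        assume "w \<noteq> x"
        then have ne: "i \<noteq> v" using v i by simp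
        have "u ! i < u ! k" using C code by blast
        then have "?c i \<le> ?c k" by (intro div_le_mono) simp
        \<comment> \<open>A base element other than \<open>v\<close> below the entry must lie below
          \<open>v\<close> as well, so \<open>v\<close> separates it from the entry.\<close>
        then have "?c i < ?c v" using ck apart[OF i(2) v(2) ne] by simp
        moreover have "?c v < ?c k" using ck by simp
        ultimately have "u ! i < u ! v \<and> u ! v < u ! k" using lt by blast
        then show False using C code v(2) by blast
      qed
    qed
  qed
qed

(* The pair number m = (x - 1) s + (y - 1) is spelled as x, y, 0 if it belongs to A and as
   0, 0, 0 otherwise, so that two consecutive nonzero letters always form a pair of A. *)
lemma exists_word_for_relation:
  assumes "s \<ge> 1"
  obtains w where "set w \<subseteq> {..s}" "length w = 3 * s\<^sup>2"
    "\<And>x y. x \<in> {1..s} \<Longrightarrow> y \<in> {1..s} \<Longrightarrow>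
      (\<exists>k. Suc k < 3 * s\<^sup>2 \<and> w ! k = x \<and> w ! Suc k = y) \<longleftrightarrow> (x, y) \<in> A"
proof
  define pair where "pair m = (Suc (m div s), Suc (m mod s))" for m
  define l where "l k = (if pair (k div 3) \<in> A \<and> k mod 3 \<noteq> 2
      then (if k mod 3 = 0 then fst (pair (k div 3)) else snd (pair (k div 3))) else 0)" for k :: nat
  define w where "w = map l [0..<3 * s\<^sup>2]"
  have div_lt: "k div 3 div s < s" if "k < 3 * s\<^sup>2" for k
    using that by (simp add: less_mult_imp_div_less power2_eq_square)
  have "l k \<le> s" if "k < 3 * s\<^sup>2" for k
    using div_lt[OF that] assms by (auto simp: l_def pair_def Suc_le_eq)
  then show "set w \<subseteq> {..s}" by (auto simp: w_def)
  show "length w = 3 * s\<^sup>2" by (simp add: w_def)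
  fix x y assume x: "x \<in> {1..s}" and y: "y \<in> {1..s}"
  have "(\<exists>k. Suc k < 3 * s\<^sup>2 \<and> w ! k = x \<and> w ! Suc k = y) \<longleftrightarrow>
      (\<exists>k. Suc k < 3 * s\<^sup>2 \<and> l k = x \<and> l (Suc k) = y)"
    by (auto simp: w_def)
  also have "\<dots> \<longleftrightarrow> (x, y) \<in> A"
  proof
    assume "\<exists>k. Suc k < 3 * s\<^sup>2 \<and> l k = x \<and> l (Suc k) = y"
    then obtain k where k: "l k = x" "l (Suc k) = y" by blast
    \<comment> \<open>The third letter of every triple is the separator 0, so two consecutive
      nonzero letters start at the beginning of a triple.\<close>
    have "k mod 3 = 0"
    proof (rule ccontr)
      assume "k mod 3 \<noteq> 0"
      moreover have "k mod 3 \<noteq> 2" using k(1) x by (auto simp: l_def)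
      moreover have "k mod 3 < 3" by simp
      ultimately have "k mod 3 = 1" by linarith
      then have "Suc k mod 3 = 2" by (simp add: mod_Suc)
      then show False using k(2) y by (simp add: l_def)
    qed
    moreover from this have "Suc k mod 3 = 1" "Suc k div 3 = k div 3" by (simp_all add: mod_Suc div_Suc)
    ultimately show "(x, y) \<in> A" using k x y by (auto simp: l_def split: if_splits)
  next
    assume A: "(x, y) \<in> A"
    obtain x' y' where xy': "x = Suc x'" "y = Suc y'" "y' < s" using x y by (cases x; cases y) auto
    define m where "m = x' * s + y'"
    have pair: "pair m = (x, y)" using xy' by (simp add: pair_def m_def)
    have "m < x * s" using xy' by (simp add: m_def)
    also have "\<dots> \<le> s * s" using x by (intro mult_right_mono) auto
    finally have "Suc (3 * m) < 3 * s\<^sup>2" by (simp add: power2_eq_square)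
    moreover have "l (3 * m) = x" using A pair by (simp add: l_def)
    moreover have "l (Suc (3 * m)) = y"
    proof -
      have "Suc (3 * m) mod 3 = 1" "Suc (3 * m) div 3 = m" by presburger+
      then show ?thesis using A pair by (simp add: l_def)
    qed
    ultimately show "\<exists>k. Suc k < 3 * s\<^sup>2 \<and> l k = x \<and> l (Suc k) = y" by blast
  qed
  finally show "(\<exists>k. Suc k < 3 * s\<^sup>2 \<and> w ! k = x \<and> w ! Suc k = y) \<longleftrightarrow> (x, y) \<in> A" .
qed

text \<open>For a relation \<open>A\<close>, take the word listing its pairs and a window that
  spells it; the positions of this window code exactly \<open>A\<close>. Only the relative order of
  values matters, so \<open>u\<close> may consist of ranks instead of values.\<close>

lemma rich_if_spells_all:
  assumes u: "spaced d H (take s u)" "spells_all d s (3 * s\<^sup>2) B u"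
    and s: "s \<ge> 1" and len: "length u = s + B * (3 * s\<^sup>2)" "length u \<le> n"
    and order: "\<And>i j. i < length u \<Longrightarrow> j < length u \<Longrightarrow> \<pi> (Suc i) < \<pi> (Suc j) \<longleftrightarrow> u ! i < u ! j"
  shows "rich n \<pi> s"
  unfolding rich_def
proof
  fix A :: "(nat \<times> nat) set"
  let ?t = "3 * s\<^sup>2"
  obtain w where w: "set w \<subseteq> {..s}" "length w = ?t"
    and spell: "\<And>x y. x \<in> {1..s} \<Longrightarrow> y \<in> {1..s} \<Longrightarrow>
      (\<exists>k. Suc k < ?t \<and> w ! k = x \<and> w ! Suc k = y) \<longleftrightarrow> (x, y) \<in> A"
    using exists_word_for_relation[OF s] by blast
  from u(2) w obtain b where b: "b < B"
    and cell: "\<And>j. j < ?t \<Longrightarrow> u ! (s + b * ?t + j) div d = letter_cell d u (w ! j)"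
    unfolding spells_all_def by blast
  define p where "p = s + b * ?t"
  have t: "?t \<ge> 1" using s by simp
  have "Suc b * ?t \<le> B * ?t" using b by (intro mult_right_mono) auto
  then have p: "p + ?t \<le> length u" by (simp add: p_def len)
  \<comment> \<open>Lists are indexed from 0 and positions from 1, so letter \<open>k\<close> of the
    window sits at position p + k + 1.\<close>
  have code: "code_in n \<pi> s (Suc (p + k)) x \<longleftrightarrow> w ! k = x" if "k < ?t" "x \<in> {1..s}" for k x
  proof (rule code_in_letter[OF u(1) _ len(2) order])
    have "w ! k \<in> set w" using w(2) that(1) by simp
    then show "w ! k \<le> s" using w(1) by auto
  qed (use p that cell[OF that(1)] len in \<open>auto simp: p_def\<close>)
  have "rel_in n \<pi> s (Suc p) (p + ?t) x y \<longleftrightarrow> (x, y) \<in> A" if xy: "x \<in> {1..s}" "y \<in> {1..s}" for x y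
  proof -
    have "rel_in n \<pi> s (Suc p) (p + ?t) x y \<longleftrightarrow>
      (\<exists>k. Suc k < ?t \<and> code_in n \<pi> s (Suc (p + k)) x \<and> code_in n \<pi> s (Suc (p + Suc k)) y)"
    proof
      assume "rel_in n \<pi> s (Suc p) (p + ?t) x y"
      then obtain q q' where q: "q \<in> {1..n}" "q' \<in> {1..n}" "Suc p \<le> q" "q' \<le> p + ?t" "succ_in n q q'"
        "code_in n \<pi> s q x" "code_in n \<pi> s q' y" unfolding rel_in_def by blast
      then have "q' = Suc q" using succ_in_iff[of q n q'] by simp
      moreover obtain k where "q = Suc p + k" using q(3) le_Suc_ex by blast
      ultimately show "\<exists>k. Suc k < ?t \<and> code_in n \<pi> s (Suc (p + k)) x \<and> code_in n \<pi> s (Suc (p + Suc k)) y"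
        using q by (intro exI[of _ k]) auto
    next
      assume "\<exists>k. Suc k < ?t \<and> code_in n \<pi> s (Suc (p + k)) x \<and> code_in n \<pi> s (Suc (p + Suc k)) y"
      then obtain k where k: "Suc k < ?t" "code_in n \<pi> s (Suc (p + k)) x" "code_in n \<pi> s (Suc (p + Suc k)) y"
        by blast
      then have "Suc (p + k) \<in> {1..n}" "Suc (p + Suc k) \<in> {1..n}" using p len(2) by auto
      then show "rel_in n \<pi> s (Suc p) (p + ?t) x y" unfolding rel_in_def
        using k by (intro bexI[of _ "Suc (p + k)"] bexI[of _ "Suc (p + Suc k)"])
          (auto simp: succ_in_iff)
    qed
    also have "\<dots> \<longleftrightarrow> (\<exists>k. Suc k < ?t \<and> w ! k = x \<and> w ! Suc k = y)"
      using code xy by (metis Suc_lessD)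
    finally show ?thesis using spell[OF xy] by simp
  qed
  moreover have "Suc p \<in> {1..n}" "p + ?t \<in> {1..n}" using p t len(2) by auto
  ultimately show "\<exists>i\<in>{1..n}. \<exists>j\<in>{1..n}. \<forall>x\<in>{1..n}. \<forall>y\<in>{1..n}. x \<le> s \<longrightarrow> y \<le> s \<longrightarrow>
     (rel_in n \<pi> s i j x y \<longleftrightarrow> (x, y) \<in> A)"
    by (intro bexI[of _ "Suc p"] bexI[of _ "p + ?t"]) auto
qed

section \<open>Rearranging the first positions of a Mallows permutation\<close>

text \<open>Positions j > K are fixed by \<open>g\<close>, and whatever stands before such a
  \<open>j\<close> stays before it. Hence (i, j) -> (g i, j) injects the inversions of
  \<open>\<pi> \<circ> g\<close> with j > K into those of \<open>\<pi>\<close>. All others lie in a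
  square with K^2 pairs.\<close>

lemma inv_count_comp_le:
  assumes \<pi>: "\<pi> permutes {1..n}" and g: "g permutes {1..K}" and K: "K \<le> n"
  shows "inv_count n (\<pi> \<circ> g) \<le> inv_count n \<pi> + K\<^sup>2"
proof -
  let ?I = "\<lambda>\<pi>. {(i, j). i \<in> {1..n} \<and> j \<in> {1..n} \<and> i < j \<and> \<pi> i > \<pi> j}"
  have fin: "finite (?I \<pi>)" for \<pi> :: "nat \<Rightarrow> nat"
    by (rule finite_subset[of _ "{1..n} \<times> {1..n}"]) auto
  let ?f = "\<lambda>(i, j). (g i, j)"
  have "?f ` (?I (\<pi> \<circ> g) - {1..K} \<times> {1..K}) \<subseteq> ?I \<pi>"
  proof
    fix a assume "a \<in> ?f ` (?I (\<pi> \<circ> g) - {1..K} \<times> {1..K})"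
    then obtain x where x: "a = ?f x" "x \<in> ?I (\<pi> \<circ> g)" "x \<notin> {1..K} \<times> {1..K}"
      by blast
    obtain i j where "x = (i, j)" by fastforce
    with x have a: "a = (g i, j)" and I: "(i, j) \<in> ?I (\<pi> \<circ> g)" and "(i, j) \<notin> {1..K} \<times> {1..K}"
      by simp_all
    moreover from I have ij: "i \<in> {1..n}" "j \<in> {1..n}" "i < j" "\<pi> (g j) < \<pi> (g i)" by simp_all
    ultimately have "\<not> (i \<in> {1..K} \<and> j \<in> {1..K})" by blast
    with ij have "j > K" by auto
    then have "g j = j" using permutes_not_in[OF g, of j] by simp
    moreover have "g i \<in> {1..n} \<and> g i < j"
    proof (cases "i \<le> K")
      case True
      then have "g i \<in> {1..K}" using permutes_in_image[OF g, of i] ij(1) by simp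
      then show ?thesis using \<open>j > K\<close> K by auto
    next
      case False
      then show ?thesis using permutes_not_in[OF g, of i] ij by simp
    qed
    ultimately show "a \<in> ?I \<pi>" using a ij by simp
  qed
  moreover have "inj_on ?f (?I (\<pi> \<circ> g) - {1..K} \<times> {1..K})"
    using permutes_inj[OF g] by (auto simp: inj_on_def)
  ultimately have "card (?I (\<pi> \<circ> g) - {1..K} \<times> {1..K}) \<le> card (?I \<pi>)"
    using fin by (intro card_inj_on_le)
  moreover have "card (?I (\<pi> \<circ> g)) \<le> card (?I (\<pi> \<circ> g) - {1..K} \<times> {1..K}) + card ({1..K} \<times> {1..K})"
    using diff_card_le_card_Diff[of "{1..K} \<times> {1..K}" "?I (\<pi> \<circ> g)"] by simp
  ultimately show ?thesis unfolding inv_count_def by (simp add: power2_eq_square)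
qed

lemma weight_comp_le:
  fixes q :: real
  assumes \<pi>: "\<pi> permutes {1..n}" and g: "g permutes {1..K}" and K: "K \<le> n" and q: "q > 0"
  shows "q ^ inv_count n (\<pi> \<circ> g) \<le> max q (1 / q) ^ K\<^sup>2 * q ^ inv_count n \<pi>"
proof (cases "q \<ge> 1")
  case True
  have "q ^ inv_count n (\<pi> \<circ> g) \<le> q ^ (inv_count n \<pi> + K\<^sup>2)"
    by (rule power_increasing[OF inv_count_comp_le[OF \<pi> g K] True])
  moreover have "max q (1 / q) = q"
    using True by (intro max_absorb1) (simp add: divide_le_eq mult_le_one order.trans[of 1 "q" "q * q"])
  ultimately show ?thesis by (simp add: power_add mult.commute)
next
  case False
  \<comment> \<open>For q < 1 the weight decreases with the number of inversions, so the opposite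
    bound is needed. It comes from undoing \<open>g\<close> by its inverse.\<close>
  have "(\<pi> \<circ> g) permutes {1..n}"
    using permutes_compose[OF permutes_subset[OF g] \<pi>] K by simp
  from inv_count_comp_le[OF this permutes_inv[OF g] K]
  have "inv_count n \<pi> \<le> inv_count n (\<pi> \<circ> g) + K\<^sup>2"
    by (simp add: comp_assoc permutes_inv_o[OF g])
  then have "q ^ (inv_count n (\<pi> \<circ> g) + K\<^sup>2) \<le> q ^ inv_count n \<pi>"
    using False q by (intro power_decreasing) auto
  then have "q ^ inv_count n (\<pi> \<circ> g) \<le> (1 / q) ^ K\<^sup>2 * q ^ inv_count n \<pi>"
    using q by (simp add: power_add field_simps)
  moreover have "(1 / q) ^ K\<^sup>2 \<le> max q (1 / q) ^ K\<^sup>2"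
    using q by (intro power_mono) auto
  ultimately show ?thesis using q by (meson mult_right_mono order.trans zero_le_power less_imp_le)
qed

text \<open>For each \<open>u\<close>, composing with \<open>g u\<close> permutes the sample space
  and changes weights by a bounded factor. Averaging over \<open>u\<close> and exchanging the sums
  leaves the fraction of bad rearrangements of a single permutation, which \<open>avg\<close>
  bounds.\<close>

lemma mallows_prob_le_orbit_average:
  fixes bad :: "(nat \<Rightarrow> nat) \<Rightarrow> bool"
  assumes U: "finite U" "U \<noteq> {}" and g: "\<And>u. u \<in> U \<Longrightarrow> g u permutes {1..K}" and K: "K \<le> n" and q: "q > 0"
    and avg: "\<And>\<pi>. \<pi> permutes {1..n} \<Longrightarrow> real (card {u\<in>U. bad (\<pi> \<circ> g u)}) \<le> \<delta> * real (card U)"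
  shows "measure_pmf.prob (mallows n q) {\<pi>. bad \<pi>} \<le> max q (1 / q) ^ K\<^sup>2 * \<delta>"
proof -
  let ?S = "{\<pi>. \<pi> permutes {1..n}}" and ?C = "max q (1 / q) ^ K\<^sup>2"
  define p where "p = pmf (mallows n q)"
  have fin: "finite ?S" by (rule finite_permutations) simp
  have supp: "set_pmf (mallows n q) \<subseteq> ?S" by (auto simp: set_pmf_iff pmf_mallows[OF q] split: if_splits)
  have p_sum: "(\<Sum>\<pi>\<in>?S. p \<pi>) = 1"
    unfolding p_def by (rule sum_pmf_eq_1[OF fin supp])
  have prob: "measure_pmf.prob (mallows n q) {\<pi>. bad \<pi>} = (\<Sum>\<pi>\<in>?S. if bad \<pi> then p \<pi> else 0)"
  proof -
    have "measure_pmf.prob (mallows n q) {\<pi>. bad \<pi>} = measure_pmf.prob (mallows n q) {\<pi>\<in>?S. bad \<pi>}"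
      by (rule measure_pmf.finite_measure_eq_AE) (use supp in \<open>auto simp: AE_measure_pmf_iff\<close>)
    also have "\<dots> = (\<Sum>\<pi>\<in>{\<pi>\<in>?S. bad \<pi>}. p \<pi>)"
      unfolding p_def using fin by (intro measure_measure_pmf_finite) simp
    also have "\<dots> = (\<Sum>\<pi>\<in>?S. if bad \<pi> then p \<pi> else 0)"
      by (rule sum.inter_filter[OF fin])
    finally show ?thesis .
  qed
  have p_comp: "p (\<pi> \<circ> g u) \<le> ?C * p \<pi>" if "\<pi> \<in> ?S" "u \<in> U" for \<pi> u
  proof -
    have perm: "\<pi> \<circ> g u permutes {1..n}"
      using permutes_compose[OF permutes_subset[OF g[OF that(2)]], of "{1..n}" \<pi>] that(1) K by simp
    have "0 \<le> (\<Sum>\<sigma> | \<sigma> permutes {1..n}. q ^ inv_count n \<sigma>)" using q by (intro sum_nonneg) auto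
    then show ?thesis
      using weight_comp_le[OF _ g[OF that(2)] K q, of \<pi>] that(1) perm
      by (simp add: p_def pmf_mallows[OF q] divide_right_mono)
  qed
  have "real (card U) * measure_pmf.prob (mallows n q) {\<pi>. bad \<pi>} =
      (\<Sum>u\<in>U. \<Sum>\<pi>\<in>?S. if bad \<pi> then p \<pi> else 0)"
    by (simp add: prob)
  also have "\<dots> = (\<Sum>u\<in>U. \<Sum>\<pi>\<in>?S. if bad (\<pi> \<circ> g u) then p (\<pi> \<circ> g u) else 0)"
  proof (rule sum.cong[OF refl])
    fix u assume "u \<in> U"
    then have "g u permutes {1..n}" using permutes_subset[OF g] K by simp
    then show "(\<Sum>\<pi>\<in>?S. if bad \<pi> then p \<pi> else 0) =
        (\<Sum>\<pi>\<in>?S. if bad (\<pi> \<circ> g u) then p (\<pi> \<circ> g u) else 0)"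
      by (rule sum_permutations_compose_right)
  qed
  also have "\<dots> \<le> (\<Sum>u\<in>U. \<Sum>\<pi>\<in>?S. if bad (\<pi> \<circ> g u) then ?C * p \<pi> else 0)"
    using p_comp by (intro sum_mono) auto
  also have "\<dots> = (\<Sum>\<pi>\<in>?S. \<Sum>u\<in>U. if bad (\<pi> \<circ> g u) then ?C * p \<pi> else 0)" by (rule sum.swap)
  also have "\<dots> = (\<Sum>\<pi>\<in>?S. real (card {u\<in>U. bad (\<pi> \<circ> g u)}) * (?C * p \<pi>))"
    using U(1) by (simp add: sum.inter_filter[symmetric])
  also have "\<dots> \<le> (\<Sum>\<pi>\<in>?S. (\<delta> * real (card U)) * (?C * p \<pi>))"
    using avg q by (intro sum_mono mult_right_mono) (auto simp: p_def intro!: mult_nonneg_nonneg zero_le_power)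
  also have "\<dots> = real (card U) * (?C * \<delta>) * (\<Sum>\<pi>\<in>?S. p \<pi>)"
    by (subst sum_distrib_left) (simp add: mult_ac)
  finally have "real (card U) * measure_pmf.prob (mallows n q) {\<pi>. bad \<pi>} \<le> real (card U) * (?C * \<delta>)"
    unfolding p_sum by simp
  moreover have "real (card U) > 0" using U by (simp add: card_gt_0_iff)
  ultimately show ?thesis by (simp only: mult_le_cancel_left_pos)
qed

text \<open>One element at a time: the next position is not moved by the permutation built so far,
  so composing with a transposition sends it to the new element without disturbing the earlier
  values.\<close>

lemma exists_permutation_to_list:
  assumes "distinct (vs :: nat list)" "set vs \<inter> {1..length vs} = {}"
  shows "\<exists>g. g permutes ({1..length vs} \<union> set vs) \<and> (\<forall>i<length vs. g (Suc i) = vs ! i)"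
  using assms
proof (induction vs rule: rev_induct)
  case Nil
  show ?case by (rule exI[of _ id]) (simp add: permutes_id flip: id_def)
next
  case (snoc x vs)
  let ?m = "Suc (length vs)"
  have "set vs \<inter> {1..length vs} = {}" using snoc.prems(2) by auto
  with snoc obtain g where g: "g permutes ({1..length vs} \<union> set vs)" "\<And>i. i < length vs \<Longrightarrow> g (Suc i) = vs ! i"
    by auto
  have x: "x \<notin> set vs" "x \<notin> {1..?m}" "?m \<notin> set vs" using snoc.prems by auto
  let ?h = "Transposition.transpose ?m x \<circ> g"
  have "?h permutes ({1..length (vs @ [x])} \<union> set (vs @ [x]))"
    by (rule permutes_compose[OF permutes_subset[OF g(1)] permutes_swap_id]) auto
  moreover have "?h (Suc i) = (vs @ [x]) ! i" if i: "i < length (vs @ [x])" for i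
  proof (cases "i < length vs")
    case True
    then have "vs ! i \<in> set vs" by simp
    then have "vs ! i \<noteq> x" "vs ! i \<noteq> ?m" using x by auto
    then show ?thesis using True g(2) by (simp add: nth_append Transposition.transpose_apply_other)
  next
    case False
    then have "i = length vs" using i by simp
    moreover have "g ?m = ?m" using permutes_not_in[OF g(1), of ?m] x by simp
    ultimately show ?thesis by simp
  qed
  ultimately show ?case by blast
qed

text \<open>The first \<open>J\<close> positions are filled with the values at \<open>J\<close>
  positions drawn from the next \<open>R\<close>. Replacing each of these by the rank of its value
  within the block turns the question into counting lists over \<open>{..<R}\<close>, a count
  independent of the permutation.\<close>

lemma prob_not_rich_le_card:
  fixes s d H B :: nat
  defines "t \<equiv> 3 * s\<^sup>2"
  defines "R \<equiv> H * d" and "J \<equiv> s + B * t"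
  assumes s: "s \<ge> 1" and R: "R > 0" and K: "J + R \<le> n" and q: "q > 0"
  shows "measure_pmf.prob (mallows n q) {\<pi>. \<not> rich n \<pi> s} \<le> max q (1 / q) ^ (J + R)\<^sup>2 *
    (card {u. set u \<subseteq> {..<R} \<and> length u = J \<and>
      \<not> (distinct u \<and> spaced d H (take s u) \<and> spells_all d s t B u)} / real R ^ J)"
proof -
  let ?P = "{J + 1..J + R}"
  let ?bad = "{u. set u \<subseteq> {..<R} \<and> length u = J \<and>
      \<not> (distinct u \<and> spaced d H (take s u) \<and> spells_all d s t B u)}"
  define U where "U = {vs. set vs \<subseteq> ?P \<and> length vs = J}"
  have U: "finite U" "card U = R ^ J"
    by (auto simp: U_def finite_lists_length_eq card_lists_length_eq)
  \<comment> \<open>No permutation realises a list with repetitions. Such a list gets an arbitrary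
    one, as it is counted as bad anyway.\<close>
  have ex: "\<exists>g. g permutes {1..J + R} \<and> (distinct vs \<longrightarrow> (\<forall>i<J. g (Suc i) = vs ! i))" if vs: "vs \<in> U" for vs
  proof (cases "distinct vs")
    case True
    have "set vs \<inter> {1..length vs} = {}" using vs by (auto simp: U_def)
    from exists_permutation_to_list[OF True this] obtain g
      where "g permutes ({1..length vs} \<union> set vs)" "\<forall>i<length vs. g (Suc i) = vs ! i" by blast
    moreover have "{1..length vs} \<union> set vs \<subseteq> {1..J + R}" using vs by (auto simp: U_def)
    ultimately have "g permutes {1..J + R}" "\<forall>i<J. g (Suc i) = vs ! i"
      using vs permutes_subset by (blast, simp add: U_def)
    then show ?thesis by blast
  qed (use permutes_id in blast)
  then obtain g where g: "\<And>vs. vs \<in> U \<Longrightarrow> g vs permutes {1..J + R}"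
    and g_nth: "\<And>vs i. vs \<in> U \<Longrightarrow> distinct vs \<Longrightarrow> i < J \<Longrightarrow> g vs (Suc i) = vs ! i" by metis
  show ?thesis
  proof (rule mallows_prob_le_orbit_average[OF U(1) _ g K q])
    have "card U > 0" using U(2) R by simp
    then show "U \<noteq> {}" by auto
    fix \<pi> :: "nat \<Rightarrow> nat" assume "\<pi> permutes {1..n}"
    then have inj: "inj \<pi>" by (rule permutes_inj)
    \<comment> \<open>Ranks preserve the order of the values on the block and embed it into
      \<open>{..<R}\<close>, so \<open>map rk\<close> carries bad choices injectively to bad
      lists.\<close>
    define rk where "rk r = card {r'\<in>?P. \<pi> r' < \<pi> r}" for r
    have mono: "rk r < rk r'" if "\<pi> r < \<pi> r'" "r \<in> ?P" for r r'
      unfolding rk_def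
    proof (rule psubset_card_mono)
      show "{x\<in>?P. \<pi> x < \<pi> r} \<subset> {x\<in>?P. \<pi> x < \<pi> r'}"
      proof (rule psubsetI)
        show "{x\<in>?P. \<pi> x < \<pi> r} \<subseteq> {x\<in>?P. \<pi> x < \<pi> r'}" using that(1) by auto
        show "{x\<in>?P. \<pi> x < \<pi> r} \<noteq> {x\<in>?P. \<pi> x < \<pi> r'}" using that by blast
      qed
    qed simp
    have rk_less: "rk r < rk r' \<longleftrightarrow> \<pi> r < \<pi> r'" if "r \<in> ?P" "r' \<in> ?P" for r r'
      using mono[of r r'] mono[of r' r] that inj by (metis injD less_asym linorder_neqE_nat)
    have rk_inj: "inj_on rk ?P"
    proof (rule inj_onI)
      fix r r' assume "r \<in> ?P" "r' \<in> ?P" "rk r = rk r'"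
      then have "\<pi> r = \<pi> r'" using rk_less[of r r'] rk_less[of r' r] by simp
      then show "r = r'" using inj by (simp add: inj_eq)
    qed
    have rk_lt: "rk r < R" if "r \<in> ?P" for r
    proof -
      have "rk r \<le> card (?P - {r})" unfolding rk_def by (rule card_mono) auto
      also have "\<dots> < card ?P" using that by (intro card_Diff1_less) auto
      finally show ?thesis by simp
    qed
    have good: "rich n (\<pi> \<circ> g vs) s" if vs: "vs \<in> U" and u: "distinct (map rk vs)"
      "spaced d H (take s (map rk vs))" "spells_all d s t B (map rk vs)" for vs
    proof (rule rich_if_spells_all[OF u(2) u(3)[unfolded t_def] s])
      show "length (map rk vs) = s + B * (3 * s\<^sup>2)" "length (map rk vs) \<le> n"
        using vs K by (auto simp: U_def J_def t_def)
      fix i j assume ij: "i < length (map rk vs)" "j < length (map rk vs)"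
      have "distinct vs" using u(1) by (simp add: distinct_map)
      moreover have "set vs \<subseteq> ?P" using vs by (simp add: U_def)
      then have "vs ! i \<in> ?P" "vs ! j \<in> ?P" using ij nth_mem[of i vs] nth_mem[of j vs] by (simp_all only: length_map) blast+
      ultimately show "(\<pi> \<circ> g vs) (Suc i) < (\<pi> \<circ> g vs) (Suc j) \<longleftrightarrow> map rk vs ! i < map rk vs ! j"
        using ij vs g_nth[OF vs] rk_less by (simp add: U_def)
    qed
    have "map rk ` {vs\<in>U. \<not> rich n (\<pi> \<circ> g vs) s} \<subseteq> ?bad"
    proof
      fix u assume "u \<in> map rk ` {vs\<in>U. \<not> rich n (\<pi> \<circ> g vs) s}"
      then obtain vs where vs: "vs \<in> U" "\<not> rich n (\<pi> \<circ> g vs) s" "u = map rk vs" by blast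
      then have "set u \<subseteq> {..<R}" "length u = J" using rk_lt by (auto simp: U_def)
      with vs good[OF vs(1)] show "u \<in> ?bad" by blast
    qed
    moreover have "inj_on (map rk) {vs\<in>U. \<not> rich n (\<pi> \<circ> g vs) s}"
    proof (rule inj_on_subset[OF inj_on_mapI])
      have "(\<Union>vs\<in>U. set vs) \<subseteq> ?P" by (auto simp only: U_def mem_Collect_eq)
      then show "inj_on rk (\<Union>vs\<in>U. set vs)" by (rule inj_on_subset[OF rk_inj])
    qed simp
    moreover have "finite ?bad"
      by (rule finite_subset[OF _ finite_lists_length_eq[of "{..<R}" J]]) auto
    ultimately have "card {vs\<in>U. \<not> rich n (\<pi> \<circ> g vs) s} \<le> card ?bad" by (intro card_inj_on_le)
    then show "real (card {vs\<in>U. \<not> rich n (\<pi> \<circ> g vs) s}) \<le> card ?bad / real R ^ J * real (card U)"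
      using R by (simp add: U(2))
  qed
qed

text \<open>Bernoulli's inequality turns the first two summands into a birthday term and a spacing
  term, and the third simplifies exactly because d / R = 1 / H. The bounds
  \<open>5 * s \<le> H\<close> and \<open>JR\<close> keep the subtractions of natural numbers
  exact.\<close>

lemma card_bad_lists_fraction:
  fixes d H s t B :: nat
  assumes "d > 0" and H: "H > 0" "5 * s \<le> H" and JR: "s + B * t \<le> H * d"
  defines "R \<equiv> H * d" and "J \<equiv> s + B * t"
  shows "card {u. set u \<subseteq> {..<R} \<and> length u = J \<and>
      \<not> (distinct u \<and> spaced d H (take s u) \<and> spells_all d s t B u)} / real R ^ J
    \<le> (real J)\<^sup>2 / R + 5 * (real s)\<^sup>2 / H + real (Suc s) ^ t * (1 - 1 / real H ^ t) ^ B"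
proof -
  have R: "real R > 0" using assms(1) H by (simp add: R_def)
  have bernoulli: "1 - (1 - x / y) ^ m \<le> m * x / y" if "0 \<le> x" "x \<le> y" "y > 0" for x y :: real and m
    using Bernoulli_inequality[of "- (x / y)" m] that by simp
  have diff: "real (a ^ m - b ^ m) = real a ^ m - real b ^ m" if "b \<le> a" for a b m :: nat
    using that by (simp add: of_nat_diff power_mono)
  have 1: "real (R ^ J - (R - J) ^ J) / R ^ J \<le> (real J)\<^sup>2 / R"
  proof -
    have "J \<le> R" using JR by (simp add: R_def J_def)
    then have "real (R ^ J - (R - J) ^ J) / R ^ J = 1 - (1 - real J / R) ^ J"
      using R by (simp add: diff of_nat_diff diff_divide_distrib power_divide[symmetric])
    also have "\<dots> \<le> real J * real J / R" using bernoulli[of J R J] R \<open>J \<le> R\<close> by simp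
    finally show ?thesis by (simp add: power2_eq_square)
  qed
  have 2: "real ((R ^ s - (R - 5 * s * d) ^ s) * R ^ (B * t)) / R ^ J \<le> 5 * (real s)\<^sup>2 / H"
  proof -
    define e where "e = 5 * s * d"
    have le: "e \<le> R" using H(2) by (simp add: R_def e_def)
    have "real ((R ^ s - (R - e) ^ s) * R ^ (B * t)) / R ^ J = real (R ^ s - (R - e) ^ s) / R ^ s"
      unfolding J_def power_add using R by simp
    also have "\<dots> = 1 - (1 - real e / R) ^ s"
      using R le by (simp add: diff of_nat_diff diff_divide_distrib power_divide[symmetric])
    finally have "real ((R ^ s - (R - 5 * s * d) ^ s) * R ^ (B * t)) / R ^ J = 1 - (1 - real (5 * s * d) / R) ^ s"
      by (simp only: e_def)
    also have "\<dots> = 1 - (1 - real (5 * s) / H) ^ s" using assms(1) by (simp add: R_def)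
    also have "\<dots> \<le> real s * real (5 * s) / H" using bernoulli[of "real (5 * s)" H s] H by simp
    also have "\<dots> = 5 * (real s)\<^sup>2 / H" by (simp add: power2_eq_square)
    finally show ?thesis .
  qed
  have 3: "real (Suc s ^ t * (R ^ s * (R ^ t - d ^ t) ^ B)) / R ^ J = real (Suc s) ^ t * (1 - 1 / real H ^ t) ^ B"
  proof -
    have "d \<le> R" using H by (simp add: R_def)
    have "real R ^ J = real R ^ s * (real R ^ t) ^ B"
      by (simp add: J_def power_add mult.commute flip: power_mult)
    then have "real (Suc s ^ t * (R ^ s * (R ^ t - d ^ t) ^ B)) / R ^ J =
      real (Suc s) ^ t * (real (R ^ t - d ^ t) / real R ^ t) ^ B"
      using R by (simp add: power_divide)
    also have "real (R ^ t - d ^ t) / real R ^ t = 1 - 1 / real H ^ t"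
      using R \<open>d \<le> R\<close> by (simp add: diff diff_divide_distrib) (simp add: R_def power_mult_distrib)
    finally show ?thesis .
  qed
  have "card {u. set u \<subseteq> {..<R} \<and> length u = J \<and>
      \<not> (distinct u \<and> spaced d H (take s u) \<and> spells_all d s t B u)} / real R ^ J
    \<le> real ((R ^ J - (R - J) ^ J) + (R ^ s - (R - 5 * s * d) ^ s) * R ^ (B * t)
      + Suc s ^ t * (R ^ s * (R ^ t - d ^ t) ^ B)) / real R ^ J"
    using card_bad_lists[OF assms(1) H(1), of s B t] unfolding R_def J_def
    by (intro divide_right_mono of_nat_mono) auto
  also have "\<dots> = real (R ^ J - (R - J) ^ J) / R ^ J + real ((R ^ s - (R - 5 * s * d) ^ s) * R ^ (B * t)) / R ^ J
     + real (Suc s ^ t * (R ^ s * (R ^ t - d ^ t) ^ B)) / R ^ J"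
    by (simp add: add_divide_distrib)
  also have "\<dots> \<le> (real J)\<^sup>2 / R + 5 * (real s)\<^sup>2 / H + real (Suc s) ^ t * (1 - 1 / real H ^ t) ^ B"
    unfolding 3 using 1 2 by linarith
  finally show ?thesis .
qed

section \<open>Choice of parameters\<close>

text \<open>This is s + B t for word length t = 3 s^2 and B = H^(3 t) windows, where H = s^3 is the
  number of cells.\<close>

definition letters_used :: "nat \<Rightarrow> nat" where
  "letters_used s = s + (s ^ 3) ^ (9 * s\<^sup>2) * (3 * s\<^sup>2)"

text \<open>With J letters, this adds a block of H d positions, where H = s^3 and d = J^2.\<close>

definition positions_used :: "nat \<Rightarrow> nat" where
  "positions_used s = letters_used s + s ^ 3 * (letters_used s)\<^sup>2"

text \<open>With these parameters the three error terms are at most 1/s, 5/s and 1/s, and the change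
  of weight costs a factor of at most e <= 3. This accounts for 21 = 3 * 7.\<close>

lemma prob_not_rich_le:
  assumes s: "s \<ge> 5" and n: "positions_used s \<le> n" and L: "(positions_used s)\<^sup>2 + 2 \<le> L"
    and q: "1 - 1 / real L < q" "q < 1 + 1 / real L"
  shows "measure_pmf.prob (mallows n q) {\<pi>. \<not> rich n \<pi> s} \<le> 21 / s"
proof -
  define H where "H = s ^ 3"
  define t where "t = 3 * s\<^sup>2"
  define B where "B = H ^ (3 * t)"
  define J where "J = s + B * t"
  define d where "d = J\<^sup>2"
  have J: "J = letters_used s"
    by (simp add: J_def B_def H_def t_def letters_used_def)
  then have K: "J + H * d = positions_used s"
    by (simp add: positions_used_def d_def H_def)
  have "J \<ge> s" by (simp add: J_def)
  then have d: "d > 0" "J \<le> d" using s by (simp_all add: d_def power2_eq_square)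
  have "5 * s \<le> s * s" using s by (rule mult_right_mono) simp
  also have "\<dots> \<le> s * (s * s)" by simp
  finally have H: "H > 0" "5 * s \<le> H" using s by (simp_all add: H_def power3_eq_cube)
  have JR: "s + B * t \<le> H * d" using d(2) H(1) unfolding J_def[symmetric] by (simp add: order.trans)
  have t: "t \<ge> 1" using s by (simp add: t_def)
  have q_pos: "q > 0"
  proof -
    have "1 / real L \<le> 1" using L by simp
    then show ?thesis using q by linarith
  qed
  let ?\<delta> = "card {u. set u \<subseteq> {..<H * d} \<and> length u = J \<and>
      \<not> (distinct u \<and> spaced d H (take s u) \<and> spells_all d s t B u)} / real (H * d) ^ J"
  have "measure_pmf.prob (mallows n q) {\<pi>. \<not> rich n \<pi> s} \<le> max q (1 / q) ^ (positions_used s)\<^sup>2 * ?\<delta>"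
    unfolding K[symmetric] unfolding J_def t_def
    by (rule prob_not_rich_le_card) (use s H d n q_pos K in \<open>simp_all add: t_def J_def\<close>)
  also have "\<dots> \<le> 3 * (7 / s)"
  proof (rule mult_mono)
    \<comment> \<open>Both q and 1/q are at most 1 + 1/(L - 1) <= exp(1/(L - 1)), and the exponent
      is below L - 1, so the power is at most e.\<close>
    have L1: "real L - 1 > 0" using L by simp
    have "1 / q \<le> 1 + 1 / (real L - 1)"
    proof -
      have "1 - 1 / real L > 0" using L1 L by simp
      then have "1 / q \<le> 1 / (1 - 1 / real L)" using q(1) q_pos by (intro divide_left_mono) auto
      also have "\<dots> = 1 + 1 / (real L - 1)" using L1 L by (simp add: field_simps)
      finally show ?thesis .
    qed
    moreover have "q \<le> 1 + 1 / (real L - 1)"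
    proof -
      have "1 / real L \<le> 1 / (real L - 1)" using L1 by (intro divide_left_mono) auto
      then show ?thesis using q(2) by linarith
    qed
    ultimately have "max q (1 / q) \<le> 1 + 1 / (real L - 1)" by simp
    also have "\<dots> \<le> exp (1 / (real L - 1))" by (rule exp_ge_add_one_self)
    finally have "max q (1 / q) ^ (positions_used s)\<^sup>2 \<le> exp (1 / (real L - 1)) ^ (positions_used s)\<^sup>2"
      using q_pos by (intro power_mono) auto
    also have "\<dots> = exp (real ((positions_used s)\<^sup>2) * (1 / (real L - 1)))"
      by (rule exp_of_nat_mult[symmetric])
    also have "\<dots> \<le> exp 1"
    proof -
      have "(positions_used s)\<^sup>2 + 1 \<le> L" using L by linarith
      then have "real ((positions_used s)\<^sup>2 + 1) \<le> real L" by (rule of_nat_mono)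
      then have "real ((positions_used s)\<^sup>2) \<le> real L - 1" by simp
      then show ?thesis using L1 by (simp add: divide_le_eq)
    qed
    also have "\<dots> \<le> 3" by (rule exp_le)
    finally show "max q (1 / q) ^ (positions_used s)\<^sup>2 \<le> 3" .
  next
    define y where "y = real H ^ t"
    have y: "y \<ge> s" "real (Suc s) ^ t \<le> y"
    proof -
      have "Suc s \<le> H" using H s by simp
      then show "real (Suc s) ^ t \<le> y" unfolding y_def by (intro power_mono) auto
      moreover have "real (Suc s) \<le> real (Suc s) ^ t" using t by (intro self_le_power) auto
      ultimately show "y \<ge> s" by simp
    qed
    have y1: "y \<ge> 1" using y(1) s by simp
    have B: "real B = y ^ 3" by (simp add: B_def y_def power_mult mult.commute)
    \<comment> \<open>Since (1 - 1/y)(1 + 1/y) <= 1, it suffices that (1 + 1/y)^B >= y^2, which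
      Bernoulli's inequality gives for B = y^3. There are at most y words, so together they
      contribute at most 1/y.\<close>
    have "(1 - 1 / y) ^ B \<le> 1 / y\<^sup>2"
    proof -
      have "(1 - 1 / y) ^ B * (1 + 1 / y) ^ B = (1 - (1 / y)\<^sup>2) ^ B"
        by (simp add: power_mult_distrib[symmetric] power2_eq_square algebra_simps)
      also have "\<dots> \<le> 1" using y1 by (intro power_le_one) (auto simp: power_le_one)
      finally have "(1 - 1 / y) ^ B * (1 + 1 / y) ^ B \<le> 1" .
      moreover have "y\<^sup>2 \<le> (1 + 1 / y) ^ B"
      proof -
        have "y\<^sup>2 \<le> 1 + real B * (1 / y)" using y1 by (simp add: B power3_eq_cube power2_eq_square)
        also have "\<dots> \<le> (1 + 1 / y) ^ B" using y1 by (intro Bernoulli_inequality) (simp add: order.trans[of "-1" 0])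
        finally show ?thesis .
      qed
      moreover have "(1 - 1 / y) ^ B \<ge> 0" using y1 by simp
      ultimately have "(1 - 1 / y) ^ B * y\<^sup>2 \<le> 1" by (meson mult_left_mono order.trans)
      then show ?thesis using y1 by (simp add: pos_le_divide_eq)
    qed
    then have "real (Suc s) ^ t * (1 - 1 / y) ^ B \<le> y * (1 / y\<^sup>2)"
      using y y1 by (intro mult_mono) auto
    also have "\<dots> = 1 / y" using y1 by (simp add: power2_eq_square)
    also have "\<dots> \<le> 1 / s" using y s by (intro divide_left_mono) auto
    finally have "real (Suc s) ^ t * (1 - 1 / y) ^ B \<le> 1 / s" .
    moreover have "(real J)\<^sup>2 / (H * d) \<le> 1 / s"
    proof -
      have "(real J)\<^sup>2 / (H * d) = 1 / H" using d by (simp add: d_def)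
      also have "\<dots> \<le> 1 / s" using H s by (intro divide_left_mono) auto
      finally show ?thesis .
    qed
    moreover have "5 * (real s)\<^sup>2 / H = 5 / s"
      using s by (simp add: H_def power2_eq_square power3_eq_cube)
    moreover have "?\<delta> \<le> (real J)\<^sup>2 / (H * d) + 5 * (real s)\<^sup>2 / H + real (Suc s) ^ t * (1 - 1 / y) ^ B"
      using card_bad_lists_fraction[OF d(1) H JR] by (simp add: J_def y_def)
    ultimately show "?\<delta> \<le> 7 / s" by (simp add: add_divide_distrib[symmetric])
  qed (use q_pos in auto)
  finally show ?thesis by simp
qed

text \<open>The square of \<open>positions_used s\<close> is at most 2^(136 s^3), a single
  exponential, whereas \<open>tower s\<close> is 2 to the power \<open>tower (s - 1)\<close>, which
  is at least 137 s^3 in this range.\<close>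

lemma positions_used_le_tower:
  assumes s: "s \<ge> 25"
  shows "(positions_used s)\<^sup>2 + 2 \<le> tower s"
proof -
  let ?e = "s ^ 3"
  have e: "s \<le> ?e" "1 \<le> ?e" "s\<^sup>2 \<le> ?e"
    using s by (simp_all add: self_le_power power_increasing)
  have s2: "s \<le> 2 ^ s" by (simp add: less_imp_le)
  have H: "s ^ 3 \<le> 2 ^ (3 * s)" using power_mono[OF s2, of 3] by (simp add: power_mult[symmetric] mult.commute)
  have B: "(s ^ 3) ^ (9 * s\<^sup>2) \<le> 2 ^ (27 * ?e)"
    using power_mono[OF H, of "9 * s\<^sup>2"] by (simp add: power_mult[symmetric] power2_eq_square power3_eq_cube mult_ac)
  have t: "3 * s\<^sup>2 \<le> 2 ^ (2 + 2 * s)"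
    using power_mono[OF s2, of 2] by (simp add: power_add power_mult[symmetric] mult.commute)
  have "letters_used s \<le> 2 ^ s + 2 ^ (27 * ?e) * 2 ^ (2 + 2 * s)"
    unfolding letters_used_def by (intro add_mono mult_mono s2 B t) auto
  also have "\<dots> \<le> 2 ^ (31 * ?e) + 2 ^ (31 * ?e)"
    unfolding power_add[symmetric] using e by (intro add_mono power_increasing) auto
  also have "\<dots> = 2 ^ Suc (31 * ?e)" by simp
  also have "\<dots> \<le> 2 ^ (32 * ?e)" using e by (intro power_increasing) auto
  finally have J: "letters_used s \<le> 2 ^ (32 * ?e)" .
  have "positions_used s \<le> 2 ^ (32 * ?e) + 2 ^ (3 * s) * (2 ^ (32 * ?e))\<^sup>2"
    unfolding positions_used_def by (intro add_mono mult_mono H J power_mono) auto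
  also have "\<dots> = 2 ^ (32 * ?e) + 2 ^ (3 * s + 64 * ?e)" by (simp add: power_add power_mult[symmetric])
  also have "\<dots> \<le> 2 ^ (67 * ?e) + 2 ^ (67 * ?e)"
    using e by (intro add_mono power_increasing) auto
  also have "\<dots> = 2 ^ Suc (67 * ?e)" by simp
  also have "\<dots> \<le> 2 ^ (68 * ?e)" using e by (intro power_increasing) auto
  finally have "(positions_used s)\<^sup>2 \<le> (2 ^ (68 * ?e))\<^sup>2" by (intro power_mono) auto
  also have "\<dots> = 2 ^ (136 * ?e)" by (simp add: power_mult[symmetric])
  finally have "(positions_used s)\<^sup>2 + 2 \<le> 2 ^ (136 * ?e) + 2 ^ (136 * ?e)"
    using power_increasing[of 1 "136 * ?e" "2::nat"] e by (intro add_mono) auto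
  also have "\<dots> = 2 ^ Suc (136 * ?e)" by simp
  also have "\<dots> \<le> 2 ^ (137 * ?e)" using e by (intro power_increasing) auto
  also have "\<dots> \<le> 2 ^ tower (s - 1)"
  proof (rule power_increasing)
    \<comment> \<open>From 25 on, passing to the next cube at most doubles it, while the power of
      two doubles exactly.\<close>
    have "137 * s ^ 3 \<le> 2 ^ (s - 1)" using s
    proof (induction s rule: dec_induct)
      case (step m)
      have "25 * (m * m) \<le> m * (m * m)" "25 * m \<le> m * m" using step(1) by (auto intro: mult_right_mono)
      moreover have "Suc m ^ 3 = m * (m * m) + 3 * (m * m) + 3 * m + 1"
        by (simp add: power3_eq_cube algebra_simps)
      moreover have "m ^ 3 = m * (m * m)" by (simp add: power3_eq_cube)
      ultimately have "Suc m ^ 3 \<le> 2 * m ^ 3" using step(1) by linarith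
      then have "137 * Suc m ^ 3 \<le> 2 * 2 ^ (m - 1)" using step.IH by linarith
      then show ?case using step(1) by (simp flip: power_Suc)
    qed simp
    also have "\<dots> \<le> 2 ^ tower (s - 2)"
      using tower_gt[of "s - 2"] s by (intro power_increasing) auto
    also have "\<dots> = tower (Suc (s - 2))" by simp
    also have "Suc (s - 2) = s - 1" using s by simp
    finally show "137 * s ^ 3 \<le> tower (s - 1)" .
  qed simp
  also have "\<dots> = tower s" using s by (simp flip: tower.simps(2))
  finally show ?thesis .
qed

section \<open>The inverse tower function and the conclusion\<close>

lemma less_log_star_iff: "k < log_star n \<longleftrightarrow> tower k < n"
proof
  assume "k < log_star n"
  then show "tower k < n" unfolding log_star_def using not_less_Least by fastforce
next
  assume "tower k < n"
  then have "tower k < tower (log_star n)" using tower_log_star[of n] by simp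
  then show "k < log_star n" by (simp add: strict_mono_less[OF strict_mono_tower])
qed

lemma log_star_le: "log_star n \<le> n"
  unfolding log_star_def by (rule Least_le) (simp add: tower_gt less_imp_le)

theorem proposition7p10:
  shows "\<exists>\<xi>. toto_sentence \<xi> \<and>
    (\<forall>\<epsilon>::real. \<epsilon> > 0 \<longrightarrow> (\<exists>n0::nat. \<forall>n\<ge>n0.
       (wowzer ^^ 2) (log_star_star (log_star_star n) - 1) < log_star (log_star (log_star n)) \<longrightarrow>
       (\<forall>q::real. q > 0 \<and> 1 - 1 / real (log_star n) < q \<and> q < 1 + 1 / real (log_star n) \<longrightarrow>
          (even (log_star_star (log_star_star n)) \<longrightarrow>
             measure_pmf.prob (mallows n q) {\<pi>. models n \<pi> \<xi>} \<ge> 1 - \<epsilon>) \<and>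
          (odd (log_star_star (log_star_star n)) \<longrightarrow>
             measure_pmf.prob (mallows n q) {\<pi>. models n \<pi> \<xi>} \<le> \<epsilon>))))"
proof (intro exI[of _ toto_xi] conjI toto_sentence_xi allI impI)
  fix \<epsilon> :: real assume \<epsilon>: "\<epsilon> > 0"
  \<comment> \<open>Once \<open>?s\<close> exceeds \<open>m\<close>, the parameter estimates apply
    and the failure probability 21 / ?s is at most \<open>\<epsilon>\<close>.\<close>
  define m where "m = max 25 (nat \<lceil>21 / \<epsilon>\<rceil>)"
  have m: "m \<ge> 25" "21 / \<epsilon> \<le> m"
  proof -
    have "21 / \<epsilon> \<le> real (nat \<lceil>21 / \<epsilon>\<rceil>)" by (rule real_nat_ceiling_ge)
    also have "\<dots> \<le> real m" by (simp add: m_def)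
    finally show "21 / \<epsilon> \<le> m" .
  qed (simp add: m_def)
  show "\<exists>n0::nat. \<forall>n\<ge>n0.
       (wowzer ^^ 2) (log_star_star (log_star_star n) - 1) < log_star (log_star (log_star n)) \<longrightarrow>
       (\<forall>q::real. q > 0 \<and> 1 - 1 / real (log_star n) < q \<and> q < 1 + 1 / real (log_star n) \<longrightarrow>
          (even (log_star_star (log_star_star n)) \<longrightarrow>
             measure_pmf.prob (mallows n q) {\<pi>. models n \<pi> toto_xi} \<ge> 1 - \<epsilon>) \<and>
          (odd (log_star_star (log_star_star n)) \<longrightarrow>
             measure_pmf.prob (mallows n q) {\<pi>. models n \<pi> toto_xi} \<le> \<epsilon>))"
  \<comment> \<open>One tower for each of the three nested \<open>log_star\<close>; the
    \<open>Suc\<close> makes the resulting inequality m < ?s strict.\<close>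
  proof (intro exI[of _ "Suc (tower (tower (tower m)))"] allI impI)
    fix n :: nat and q :: real
    let ?s = "log_star (log_star (log_star n))" and ?k = "log_star_star (log_star_star n)"
    assume n: "Suc (tower (tower (tower m))) \<le> n" and hyp: "(wowzer ^^ 2) (?k - 1) < ?s"
      and q: "q > 0 \<and> 1 - 1 / real (log_star n) < q \<and> q < 1 + 1 / real (log_star n)"
    have "m < ?s" using n by (simp add: less_log_star_iff)
    with m have s: "?s \<ge> 25" "21 / \<epsilon> \<le> ?s" by (simp_all add: order.trans)
    \<comment> \<open>This makes the square of \<open>positions_used ?s\<close> fit below
      \<open>log_star n\<close>, whose reciprocal is the allowed deviation of \<open>q\<close> from
      1.\<close>
    have L: "tower ?s \<le> log_star n"
    proof -
      have "?s - 1 < ?s" using s(1) by linarith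
      then have "tower (tower (?s - 1)) < log_star n" by (simp only: less_log_star_iff)
      moreover have "?s \<le> tower (?s - 1)" using tower_gt[of "?s - 1"] s(1) by linarith
      then have "tower ?s \<le> tower (tower (?s - 1))" by (simp add: strict_mono_less_eq[OF strict_mono_tower])
      ultimately show ?thesis by simp
    qed
    have k: "?k \<ge> 2" "n \<le> wowzer (wowzer ?k)"
    proof -
      have "n \<le> wowzer (log_star_star n)" by (rule wowzer_log_star_star)
      also have "\<dots> \<le> wowzer (wowzer ?k)"
        by (simp add: strict_mono_less_eq[OF strict_mono_wowzer] wowzer_log_star_star)
      finally show le: "n \<le> wowzer (wowzer ?k)" .
      \<comment> \<open>W(W(1)) = W(2) = 4, while \<open>n\<close> exceeds 25.\<close>
      show "?k \<ge> 2"
      proof (rule ccontr)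
        assume "\<not> ?k \<ge> 2"
        then have "wowzer (wowzer ?k) \<le> wowzer (wowzer 1)"
          by (simp add: strict_mono_less_eq[OF strict_mono_wowzer] del: wowzer.simps One_nat_def)
        also have "\<dots> = 4" by (simp add: numeral_2_eq_2)
        finally have "n \<le> 4" using le by simp
        moreover have "n > 25" using n m(1) tower_gt[of m] tower_gt[of "tower m"] tower_gt[of "tower (tower m)"]
          by linarith
        ultimately show False by simp
      qed
    qed
    have s_le: "?s \<le> n" by (rule order.trans[OF log_star_le order.trans[OF log_star_le log_star_le]])
    \<comment> \<open>Whenever \<open>?s\<close> is rich, the parity of \<open>?k\<close> alone
      decides the sentence, so the failure of richness is the only source of error. The lower bound
      required of \<open>?s\<close> is exactly \<open>hyp\<close>.\<close>
    have models: "models n \<pi> toto_xi \<longleftrightarrow> even ?k" if "rich n \<pi> ?s" for \<pi>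
      using models_xi_iff[OF that s_le k(1) _ k(2)] hyp by (simp add: numeral_2_eq_2)
    have "measure_pmf.prob (mallows n q) {\<pi>. \<not> rich n \<pi> ?s} \<le> 21 / ?s"
    proof (rule prob_not_rich_le)
      show L': "(positions_used ?s)\<^sup>2 + 2 \<le> log_star n"
        using positions_used_le_tower[OF s(1)] L by simp
      have "positions_used ?s \<le> (positions_used ?s)\<^sup>2" by (simp add: power2_eq_square)
      then show "positions_used ?s \<le> n" using L' log_star_le[of n] by linarith
    qed (use q s in auto)
    also have "\<dots> \<le> \<epsilon>" using s \<epsilon> by (simp add: field_simps)
    finally have small: "measure_pmf.prob (mallows n q) {\<pi>. \<not> rich n \<pi> ?s} \<le> \<epsilon>" .
    show "(even ?k \<longrightarrow> measure_pmf.prob (mallows n q) {\<pi>. models n \<pi> toto_xi} \<ge> 1 - \<epsilon>) \<and>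
      (odd ?k \<longrightarrow> measure_pmf.prob (mallows n q) {\<pi>. models n \<pi> toto_xi} \<le> \<epsilon>)"
    proof (intro conjI impI)
      assume "even ?k"
      then have "- {\<pi>. models n \<pi> toto_xi} \<subseteq> {\<pi>. \<not> rich n \<pi> ?s}" using models by blast
      then have "measure_pmf.prob (mallows n q) (- {\<pi>. models n \<pi> toto_xi}) \<le> \<epsilon>"
        by (rule order.trans[OF measure_pmf.finite_measure_mono small]) simp
      then show "measure_pmf.prob (mallows n q) {\<pi>. models n \<pi> toto_xi} \<ge> 1 - \<epsilon>"
        using measure_pmf.prob_compl[of "{\<pi>. models n \<pi> toto_xi}" "mallows n q"]
        by (simp add: Compl_eq_Diff_UNIV)
    next
      assume "odd ?k"
      then have "{\<pi>. models n \<pi> toto_xi} \<subseteq> {\<pi>. \<not> rich n \<pi> ?s}" using models by blast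
      then show "measure_pmf.prob (mallows n q) {\<pi>. models n \<pi> toto_xi} \<le> \<epsilon>"
        by (rule order.trans[OF measure_pmf.finite_measure_mono small]) simp
    qed
  qed
qed

end
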